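(* Let $n\ge 1$, let $v=v^i\partial_i$ be a vector field on $\mathbb{R}^{n+1}$ with components $v^i\in C^1(\mathbb{R}^{n+1})$, $i=0,\ldots,n$, let $U\subseteq\mathbb{R}^{n+1}$ be open, and let $\rho\in C^1(U)$. Then the measure $d\mu=\rho\,dx^0\wedge\cdots\wedge dx^n$ on $U$ is preserved by the flow $\dot x^i=v^i$ if and only if $$v\cdot(\nabla\rho)+\rho\,(\nabla\cdot v)=0\quad\text{on } U .$$ Moreover, ratios of independent local preserved measures provide local integrals: if $\rho_1,\rho_2\in C^1(U)$ are independent and the measures $\rho_1\,dx^0\wedge\cdots\wedge dx^n$ and $\rho_2\,dx^0\wedge\cdots\wedge dx^n$ are both preserved by the flow, then $\rho_1\rho_2^{-1}$ is an integral of the flow on the open set $\{x\in U:\rho_2(x)\neq 0\}$.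
   Context: Here $\nabla\cdot v=\sum_i\partial_i v^i$ and $v\cdot(\nabla\rho)=\sum_i v^i\partial_i\rho$. Let $\varphi_t$ denote the (local) flow of $\dot x^i=v^i(x)$. A "measure" $d\mu=\rho\,dx^0\wedge\cdots\wedge dx^n$ is given by a real density $\rho$ (not required to be positive), and the measure of a function $\Delta$ with compact support in $U$ is $\mu(\Delta)=\int\Delta\,\rho\,dx^0\cdots dx^n$. For a smooth function $\Delta$ with compact support in $U$, the transported function is $\Delta_t=\Delta\circ\varphi_t^{-1}$ on $\varphi_t(\operatorname{supp}\Delta)$, extended by zero, defined for all $t$ in an interval around $0$ for which $\varphi_s(\operatorname{supp}\Delta)$ is defined and contained in $U$ for all $s$ between $0$ and $t$. The measure $d\mu$ is preserved by the flow if for every such $\Delta$ one has $\frac{d}{dt}\mu(\Delta_t)=0$ for all such $t$. An integral of the flow on an open set $W$ is a function $I\in C^1(W)$ with $D_tI=v^i\partial_iI=0$ on $W$. Two densities $\rho_1,\rho_2$ are independent if their ratio is not constant. *)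

theory Defs
  imports "HOL-Analysis.Analysis"
begin

text \<open>
  Coordinates of \<open>\<real>\<^sup>n\<^sup>+\<^sup>1\<close> are indexed by a finite type \<open>'n\<close> with \<open>CARD('n) = n + 1\<close>.
  Functions on an open set \<open>U\<close> are total functions whose values outside \<open>U\<close> are irrelevant.
\<close>

definition partial_deriv :: "'n \<Rightarrow> (real ^ 'n \<Rightarrow> real) \<Rightarrow> real ^ 'n \<Rightarrow> real" where
  "partial_deriv i f x = deriv (\<lambda>h. f (x + h *\<^sub>R axis i 1)) 0"

text \<open>The class \<open>C\<^sup>k\<close> on a set that is meant to be open.\<close>

fun Ck_on :: "nat \<Rightarrow> (real ^ 'n) set \<Rightarrow> (real ^ 'n \<Rightarrow> real) \<Rightarrow> bool" where
  "Ck_on 0 S f \<longleftrightarrow> continuous_on S f"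
| "Ck_on (Suc k) S f \<longleftrightarrow>
     (\<forall>x\<in>S. f differentiable (at x)) \<and> (\<forall>i. Ck_on k S (partial_deriv i f))"

abbreviation C1_on :: "(real ^ 'n) set \<Rightarrow> (real ^ 'n \<Rightarrow> real) \<Rightarrow> bool" where
  "C1_on \<equiv> Ck_on 1"

definition smooth_on :: "(real ^ 'n) set \<Rightarrow> (real ^ 'n \<Rightarrow> real) \<Rightarrow> bool" where
  "smooth_on S f \<longleftrightarrow> (\<forall>k. Ck_on k S f)"

definition divergence :: "(real ^ 'n \<Rightarrow> real ^ 'n) \<Rightarrow> real ^ 'n \<Rightarrow> real" where
  "divergence v x = (\<Sum>i\<in>UNIV. partial_deriv i (\<lambda>y. v y $ i) x)"

text \<open>\<open>v \<cdot> (\<nabla>f) = v\<^sup>i \<partial>\<^sub>i f\<close>, also written \<open>D\<^sub>t f\<close>.\<close>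

definition deriv_along :: "(real ^ 'n \<Rightarrow> real ^ 'n) \<Rightarrow> (real ^ 'n \<Rightarrow> real) \<Rightarrow> real ^ 'n \<Rightarrow> real" where
  "deriv_along v f x = (\<Sum>i\<in>UNIV. v x $ i * partial_deriv i f x)"

text \<open>
  The time \<open>t\<close> may be negative, hence \<open>closed_segment 0 t\<close>. The derivatives at its two
  endpoints are one-sided.
\<close>

definition solution_upto ::
    "(real ^ 'n \<Rightarrow> real ^ 'n) \<Rightarrow> real ^ 'n \<Rightarrow> real \<Rightarrow> (real \<Rightarrow> real ^ 'n) \<Rightarrow> bool" where
  "solution_upto v x t \<gamma> \<longleftrightarrow> \<gamma> 0 = x \<and>
     (\<forall>s\<in>closed_segment 0 t.
        (\<gamma> has_vector_derivative v (\<gamma> s)) (at s within closed_segment 0 t))"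

definition flow_defined :: "(real ^ 'n \<Rightarrow> real ^ 'n) \<Rightarrow> real \<Rightarrow> real ^ 'n \<Rightarrow> bool" where
  "flow_defined v t x \<longleftrightarrow> (\<exists>\<gamma>. solution_upto v x t \<gamma>)"

text \<open>
  \<open>\<phi>\<^sub>t(x)\<close>; it is only meaningful if \<open>flow_defined v t x\<close>, and then, for \<open>v\<close> of class
  \<open>C\<^sup>1\<close>, the value does not depend on the choice of the solution.
\<close>

definition flow :: "(real ^ 'n \<Rightarrow> real ^ 'n) \<Rightarrow> real \<Rightarrow> real ^ 'n \<Rightarrow> real ^ 'n" where
  "flow v t x = (SOME \<gamma>. solution_upto v x t \<gamma>) t"

definition supp :: "(real ^ 'n \<Rightarrow> real) \<Rightarrow> (real ^ 'n) set" where
  "supp f = closure {x. f x \<noteq> 0}"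

definition test_function :: "(real ^ 'n) set \<Rightarrow> (real ^ 'n \<Rightarrow> real) \<Rightarrow> bool" where
  "test_function U \<Delta> \<longleftrightarrow> smooth_on UNIV \<Delta> \<and> compact (supp \<Delta>) \<and> supp \<Delta> \<subseteq> U"

definition admissible_times ::
    "(real ^ 'n \<Rightarrow> real ^ 'n) \<Rightarrow> (real ^ 'n) set \<Rightarrow> (real ^ 'n \<Rightarrow> real) \<Rightarrow> real set" where
  "admissible_times v U \<Delta> =
     {t. \<forall>s\<in>closed_segment 0 t. \<forall>x\<in>supp \<Delta>. flow_defined v s x \<and> flow v s x \<in> U}"

definition transport ::
    "(real ^ 'n \<Rightarrow> real ^ 'n) \<Rightarrow> (real ^ 'n \<Rightarrow> real) \<Rightarrow> real \<Rightarrow> real ^ 'n \<Rightarrow> real" where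
  "transport v \<Delta> t y =
     (if y \<in> flow v t ` supp \<Delta> then \<Delta> (inv_into (supp \<Delta>) (flow v t) y) else 0)"

definition density_measure ::
    "(real ^ 'n) set \<Rightarrow> (real ^ 'n \<Rightarrow> real) \<Rightarrow> (real ^ 'n \<Rightarrow> real) \<Rightarrow> real" where
  "density_measure U \<rho> \<Delta> = (LBINT x:U. \<Delta> x * \<rho> x)"

text \<open>
  For open \<open>U\<close> the admissible times form an open interval around \<open>0\<close>, so the derivative
  below involves only transported functions at admissible times.
\<close>

definition preserved_by_flow ::
    "(real ^ 'n \<Rightarrow> real ^ 'n) \<Rightarrow> (real ^ 'n) set \<Rightarrow> (real ^ 'n \<Rightarrow> real) \<Rightarrow> bool" where
  "preserved_by_flow v U \<rho> \<longleftrightarrow>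
     (\<forall>\<Delta>. test_function U \<Delta> \<longrightarrow>
        (\<forall>t\<in>admissible_times v U \<Delta>.
           ((\<lambda>s. density_measure U \<rho> (transport v \<Delta> s)) has_real_derivative 0) (at t)))"

definition integral_of_flow ::
    "(real ^ 'n \<Rightarrow> real ^ 'n) \<Rightarrow> (real ^ 'n) set \<Rightarrow> (real ^ 'n \<Rightarrow> real) \<Rightarrow> bool" where
  "integral_of_flow v W f \<longleftrightarrow> open W \<and> C1_on W f \<and> (\<forall>x\<in>W. deriv_along v f x = 0)"

text \<open>The ratio is taken where it is defined, i.e. where the second density does not vanish.\<close>

definition independent_densities ::
    "(real ^ 'n) set \<Rightarrow> (real ^ 'n \<Rightarrow> real) \<Rightarrow> (real ^ 'n \<Rightarrow> real) \<Rightarrow> bool" where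
  "independent_densities U \<rho>1 \<rho>2 \<longleftrightarrow>
     \<not> (\<lambda>x. \<rho>1 x / \<rho>2 x) constant_on {x\<in>U. \<rho>2 x \<noteq> 0}"

end

theory Submission
  imports Defs
begin

text \<open>
  Clamping \<open>v\<close> to a large ball makes it bounded and globally Lipschitz, so that Picard iteration
  gives a global flow \<open>\<Phi>\<close> which agrees with the given one on the trajectories of \<open>supp \<Delta>\<close> up to a
  time slightly past \<open>t\<close>. There \<open>\<Delta>\<^sub>s = \<Delta> \<circ> \<Phi> (- s)\<close>, and by the variational equation
  \<open>G = \<Delta>\<^sub>t\<close> is differentiable; it is Lipschitz by Gronwall. Dominated convergence then gives
  \<open>d/ds \<mu>(\<Delta>\<^sub>s) = - \<integral> (v \<cdot> \<nabla>G) \<rho> = \<integral> G (v \<cdot> \<nabla>\<rho> + \<rho> \<nabla> \<cdot> v)\<close> at \<open>s = t\<close>. The integration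
  by parts only needs translation invariance of Lebesgue measure, so neither a change of variables
  nor continuity of \<open>\<nabla>G\<close> enters. At \<open>t = 0\<close> testing with bump functions yields the equation.
\<close>

section \<open>Gronwall's inequality and Picard iteration\<close>

text \<open>The field need not be complete, and in the definitions the flow is a choice of solution
  made anew for each time, with its inverse an \<open>inv_into\<close>. The clamped field instead
  has a one-parameter group: the inverse at time s is time -s, and the group law turns the
  derivative at any admissible t into one at h = 0 of \<open>G (\<Phi> (- h) y)\<close>. The usual
  argument pulls the integral back to time 0 and differentiates a Jacobian determinant by
  Liouville's formula. Here the density stays in place and the derivative falls on the transported
  function, so only differentiability of each single map \<open>\<Phi> t\<close> along the relevant
  trajectories is required. The resulting formula has the left-hand side of the equation as a factor
  of the integrand and holds at every admissible time, hence serves both directions. Admissibility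
  speaks of times up to t only, whereas the derivative at t is two-sided; this is why the flow has
  to be followed beyond t, uniformly on the support.\<close>

lemma gronwall_forward:
  fixes p :: "real \<Rightarrow> 'a::real_inner"
  assumes T: "0 \<le> T" and L: "0 \<le> L" and b: "0 \<le> b"
    and deriv: "\<And>s. s \<in> {0..T} \<Longrightarrow> (p has_vector_derivative p' s) (at s within {0..T})"
    and bound: "\<And>s. s \<in> {0..T} \<Longrightarrow> norm (p' s) \<le> L * norm (p s) + b"
  shows "norm (p T) \<le> exp (L * T) * (norm (p 0) + b * T)"
proof (cases "T = 0")
  case False
  then have T0: "0 < T" using T by simp
  have key: "norm (p T) \<le> exp (L * T) * (norm (p 0) + k + b * T)" if k: "0 < k" for k
  proof -
    \<comment> \<open>The regularised norm is differentiable also where \<open>p\<close> vanishes.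
      It exceeds the norm by at most \<open>k\<close>, and \<open>k\<close> tends to 0 at the
      end.\<close>
    define n where "n s = sqrt (k\<^sup>2 + p s \<bullet> p s)" for s
    \<comment> \<open>Chosen to be nonincreasing: the factor \<open>exp (- L * s)\<close> cancels
      the growth rate \<open>L\<close>, and \<open>b * s\<close> pays for the inhomogeneity, because
      that factor is at most 1.\<close>
    define q where "q s = exp (- L * s) * n s - b * s" for s
    have pos: "0 < k\<^sup>2 + p s \<bullet> p s" for s
      using k by (simp add: add_pos_nonneg)
    have n_pos: "0 < n s" for s using pos by (simp add: n_def)
    have n_ge: "norm (p s) \<le> n s" for s
      unfolding n_def by (simp add: norm_eq_sqrt_inner)
    have n_le: "n s \<le> norm (p s) + k" for s
      unfolding n_def using sqrt_add_le_add_sqrt[of "k\<^sup>2" "p s \<bullet> p s"] k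
      by (simp add: norm_eq_sqrt_inner)
    have cont_p: "continuous_on {0..T} p"
      using deriv by (meson continuous_on_eq_continuous_within has_vector_derivative_continuous)
    have cont_q: "continuous_on {0..T} q"
      unfolding q_def n_def by (intro continuous_intros cont_p)
    have "q T \<le> q 0"
    proof (rule DERIV_nonpos_imp_decreasing_open[OF T])
      fix s assume s: "0 < s" "s < T"
      then have d: "(p has_vector_derivative p' s) (at s)"
        using deriv[of s] by (simp add: at_within_Icc_at)
      have "((\<lambda>s. p s \<bullet> p s) has_real_derivative 2 * (p s \<bullet> p' s)) (at s)"
        using has_derivative_inner[OF d[unfolded has_vector_derivative_def] d[unfolded has_vector_derivative_def]]
        unfolding has_field_derivative_def
        by (rule has_derivative_eq_rhs) (auto simp: inner_commute algebra_simps)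
      then have dn: "(n has_real_derivative (p s \<bullet> p' s) / n s) (at s)"
        unfolding n_def using pos[of s]
        by (auto intro!: derivative_eq_intros simp: field_simps)
      have dq: "(q has_real_derivative exp (- L * s) * ((p s \<bullet> p' s) / n s - L * n s) - b) (at s)"
        unfolding q_def by (auto intro!: derivative_eq_intros dn simp: algebra_simps)
      have "p s \<bullet> p' s \<le> norm (p s) * norm (p' s)" by (rule norm_cauchy_schwarz)
      also have "\<dots> \<le> n s * (L * n s + b)"
        using bound[of s] s n_ge[of s] L b n_pos[of s]
        by (intro mult_mono order_trans[OF bound]) (auto intro!: mult_left_mono)
      finally have "(p s \<bullet> p' s) / n s - L * n s \<le> b"
        using n_pos[of s] by (simp add: field_simps)
      then have "exp (- L * s) * ((p s \<bullet> p' s) / n s - L * n s) \<le> exp (- L * s) * b"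
        by (intro mult_left_mono) auto
      also have "\<dots> \<le> 1 * b"
        using s L b by (intro mult_right_mono) auto
      finally show "\<exists>y. (q has_real_derivative y) (at s) \<and> y \<le> 0"
        using dq by (intro exI conjI) auto
    qed (rule cont_q)
    then have "exp (- L * T) * n T \<le> n 0 + b * T" by (simp add: q_def)
    also have "\<dots> \<le> norm (p 0) + k + b * T" using n_le[of 0] by simp
    finally have "n T \<le> exp (L * T) * (norm (p 0) + k + b * T)"
      by (simp add: exp_minus field_simps)
    then show ?thesis using n_ge[of T] by linarith
  qed
  have "((\<lambda>k. exp (L * T) * (norm (p 0) + k + b * T)) \<longlongrightarrow> exp (L * T) * (norm (p 0) + 0 + b * T)) (at_right 0)"
    by (intro tendsto_intros)
  then have "norm (p T) \<le> exp (L * T) * (norm (p 0) + 0 + b * T)"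
    by (rule tendsto_lowerbound) (auto simp: eventually_at_right_less key intro: eventually_at_rightI[of 0 1])
  then show ?thesis by simp
qed simp

lemma has_vector_derivative_reflect:
  fixes p :: "real \<Rightarrow> 'a::real_normed_vector"
  assumes "(p has_vector_derivative d) (at (- s) within uminus ` S)"
  shows "((\<lambda>s. p (- s)) has_vector_derivative - d) (at s within S)"
proof -
  have "(uminus has_vector_derivative - 1) (at s within S)"
    by (auto intro!: derivative_eq_intros)
  from vector_diff_chain_within[OF this assms] show ?thesis by (simp add: o_def)
qed

lemma gronwall:
  fixes p :: "real \<Rightarrow> 'a::real_inner"
  assumes L: "0 \<le> L" and b: "0 \<le> b"
    and deriv: "\<And>s. s \<in> closed_segment 0 t \<Longrightarrow>
      (p has_vector_derivative p' s) (at s within closed_segment 0 t)"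
    and bound: "\<And>s. s \<in> closed_segment 0 t \<Longrightarrow> norm (p' s) \<le> L * norm (p s) + b"
  shows "norm (p t) \<le> exp (L * \<bar>t\<bar>) * (norm (p 0) + b * \<bar>t\<bar>)"
proof (cases "0 \<le> t")
  case True
  then show ?thesis
    using gronwall_forward[of t L b p p'] assms by (simp add: closed_segment_eq_real_ivl)
next
  case False
  then have seg: "closed_segment 0 t = {t..0}" by (simp add: closed_segment_eq_real_ivl)
  have im: "uminus ` {0..-t} = {t..0}" by (simp add: image_uminus_atLeastAtMost)
  have "norm (p (- (- t))) \<le> exp (L * (- t)) * (norm (p (- 0)) + b * (- t))"
  proof (rule gronwall_forward[where p = "\<lambda>s. p (- s)" and p' = "\<lambda>s. - p' (- s)"])
    fix s assume s: "s \<in> {0..- t}"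
    show "((\<lambda>s. p (- s)) has_vector_derivative - p' (- s)) (at s within {0..- t})"
      using deriv[of "- s"] s seg im by (intro has_vector_derivative_reflect) auto
    show "norm (- p' (- s)) \<le> L * norm (p (- s)) + b"
      using bound[of "- s"] s seg by auto
  qed (use False L b in auto)
  then show ?thesis using False by simp
qed

section \<open>Picard iteration on the whole line\<close>

lemma antiderivative_exists:
  fixes f :: "real \<Rightarrow> 'a::euclidean_space"
  assumes "continuous_on UNIV f"
  obtains F where "F 0 = 0" "\<And>s. (F has_vector_derivative f s) (at s)"
proof -
  \<comment> \<open>One of the two integrals always runs over an empty or degenerate interval, so
    this is the signed integral from 0 to \<open>s\<close>.\<close>
  define F where "F s = integral {0..s} f - integral {s..0} f" for s
  have int: "f integrable_on {a..c}" for a c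
    using assms by (intro integrable_continuous_real) (blast intro: continuous_on_subset)
  have "(F has_vector_derivative f s) (at s)" for s
  proof -
    \<comment> \<open>A base point to the left of both \<open>s\<close> and 0 turns \<open>F\<close>
      near \<open>s\<close> into an ordinary integral minus a constant, differentiable from both
      sides.\<close>
    define a where "a = min s 0 - 1"
    have F_eq: "F r = integral {a..r} f - integral {a..0} f" if "a \<le> r" for r :: real
    proof (cases "0 \<le> r")
      case True
      have "integral {r..0} f = 0" using True by (cases "r = 0") auto
      then show ?thesis
        using Henstock_Kurzweil_Integration.integral_combine[of a 0 r f] True int by (simp add: F_def a_def algebra_simps)
    next
      case False
      then show ?thesis
        using Henstock_Kurzweil_Integration.integral_combine[of a r 0 f] that int by (simp add: F_def algebra_simps)
    qed
    have "((\<lambda>r. integral {a..r} f) has_vector_derivative f s) (at s within {a..s + 1})"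
      using assms by (intro integral_has_vector_derivative) (auto simp: a_def intro: continuous_on_subset)
    then have "((\<lambda>r. integral {a..r} f) has_vector_derivative f s) (at s)"
      by (subst (asm) at_within_Icc_at) (auto simp: a_def)
    then have "((\<lambda>r. integral {a..r} f - integral {a..0} f) has_vector_derivative f s) (at s)"
      by (auto intro!: derivative_eq_intros)
    then show ?thesis
      by (rule has_vector_derivative_transform_within_open[where S = "{a<..}"])
        (auto simp: F_eq a_def)
  qed
  then show ?thesis using that[of F] by (simp add: F_def)
qed

text \<open>Integrating an exponential of rate \<open>\<alpha>\<close> gains a factor 1 / \<alpha>.
  This gain makes the Picard map contract once \<open>\<alpha>\<close> is large against the
  Lipschitz constant.\<close>

lemma exp_weight_bound:
  fixes F :: "real \<Rightarrow> 'a::euclidean_space"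
  assumes F0: "F 0 = 0" and der: "\<And>s. (F has_vector_derivative f s) (at s)"
    and bound: "\<And>s. norm (f s) \<le> C * exp (\<alpha> * \<bar>s\<bar>)" and \<alpha>: "0 < \<alpha>"
  shows "norm (F s) \<le> C / \<alpha> * exp (\<alpha> * \<bar>s\<bar>)"
proof -
  have C: "0 \<le> C" using order_trans[OF norm_ge_zero bound[of 0]] by simp
  have *: "norm (H r) \<le> C / \<alpha> * exp (\<alpha> * r)"
    if r: "0 \<le> r" and H0: "H 0 = 0" and der: "\<And>s. (H has_vector_derivative h s) (at s)"
      and bound: "\<And>s. norm (h s) \<le> C * exp (\<alpha> * \<bar>s\<bar>)" for H h :: "real \<Rightarrow> 'a" and r
  proof (cases "r = 0")
    case False
    then have r0: "0 < r" using r by simp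
    have "norm (H r - H 0) \<le> C / \<alpha> * exp (\<alpha> * r) - C / \<alpha> * exp (\<alpha> * 0)"
    proof (rule differentiable_bound_general[OF r0, where f' = h and \<phi>' = "\<lambda>s. C * exp (\<alpha> * s)"])
      show "continuous_on {0..r} H"
        using der by (meson continuous_at_imp_continuous_on has_vector_derivative_continuous)
      show "continuous_on {0..r} (\<lambda>a. C / \<alpha> * exp (\<alpha> * a))" by (intro continuous_intros)
      show "((\<lambda>a. C / \<alpha> * exp (\<alpha> * a)) has_vector_derivative C * exp (\<alpha> * x)) (at x)" for x
        unfolding has_real_derivative_iff_has_vector_derivative[symmetric]
        using \<alpha> by (auto intro!: derivative_eq_intros)
      show "norm (h x) \<le> C * exp (\<alpha> * x)" if "0 < x" "x < r" for x
        using bound[of x] that by simp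
    qed (rule der)
    moreover have "0 \<le> C / \<alpha>" using C \<alpha> by simp
    ultimately show ?thesis using H0 by simp
  qed (use H0 C \<alpha> in simp)
  show ?thesis
  proof (cases "0 \<le> s")
    case True
    then show ?thesis using *[of s F f] assms by simp
  next
    case False
    have "((\<lambda>s. F (- s)) has_vector_derivative - f (- s)) (at s)" for s
      using has_vector_derivative_reflect[of F "f (- s)" s UNIV] der by (simp add: surj_def) 
    then show ?thesis using *[of "- s" "\<lambda>s. F (- s)" "\<lambda>s. - f (- s)"] F0 bound False
      by (metis abs_minus_cancel abs_of_nonpos linorder_le_cases minus_minus neg_0_le_iff_le neg_equal_zero norm_minus_cancel)
  qed
qed

text \<open>Picard iteration in the norm weighted by \<open>exp (- \<alpha> \<bar>s\<bar>)\<close>, which makes it contract on the whole line.\<close>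

theorem picard_global:
  fixes f :: "real \<Rightarrow> 'a::euclidean_space \<Rightarrow> 'a"
  assumes cont: "\<And>u. continuous_on UNIV u \<Longrightarrow> continuous_on UNIV (\<lambda>s. f s (u s))"
    and lip: "\<And>s x y. norm (f s x - f s y) \<le> L * norm (x - y)"
    and bdd: "\<And>s. norm (f s x0) \<le> M"
  obtains \<gamma> where "\<gamma> 0 = x0" "\<And>s. (\<gamma> has_vector_derivative f s (\<gamma> s)) (at s)"
proof -
  \<comment> \<open>No sign of \<open>L\<close> is assumed; \<open>K\<close> is a positive Lipschitz
    constant, and \<open>\<alpha> = 2 * K\<close> makes the contraction factor
    \<open>K / \<alpha>\<close> equal to 1/2.\<close>
  define K where "K = \<bar>L\<bar> + 1"
  define \<alpha> where "\<alpha> = 2 * K"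
  have K: "0 < K" and \<alpha>: "0 < \<alpha>" by (auto simp: K_def \<alpha>_def)
  have M: "0 \<le> M" using order_trans[OF norm_ge_zero bdd] .
  have lipK: "norm (f s x - f s y) \<le> K * norm (x - y)" for s x y
    using lip[of s x y] by (rule order_trans) (auto simp: K_def intro!: mult_right_mono)
  \<comment> \<open>The unknown \<open>u\<close> is the displacement from \<open>x0\<close> divided
    by the weight. It ranges over the bounded continuous functions, a complete space, so that
    Banach's fixed point theorem applies.\<close>
  define curve where "curve u s = x0 + exp (\<alpha> * \<bar>s\<bar>) *\<^sub>R apply_bcontfun u s" for u :: "real \<Rightarrow>\<^sub>C 'a" and s
  have cont_curve: "continuous_on UNIV (\<lambda>s. f s (curve u s))" for u
    unfolding curve_def by (intro cont continuous_intros) auto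
  have "\<forall>u. \<exists>F. F 0 = 0 \<and> (\<forall>s. (F has_vector_derivative f s (curve u s)) (at s))"
    using antiderivative_exists[OF cont_curve] by metis
  then obtain F where F0: "\<And>u. F u 0 = 0"
    and F: "\<And>u s. (F u has_vector_derivative f s (curve u s)) (at s)"
    by metis
  define P where "P u = Bcontfun (\<lambda>s. exp (- \<alpha> * \<bar>s\<bar>) *\<^sub>R F u s)" for u
  have apply_P: "apply_bcontfun (P u) = (\<lambda>s. exp (- \<alpha> * \<bar>s\<bar>) *\<^sub>R F u s)" for u
    unfolding P_def
  proof (rule Bcontfun_inverse, rule bcontfun_normI)
    show "continuous_on UNIV (\<lambda>s. exp (- \<alpha> * \<bar>s\<bar>) *\<^sub>R F u s)"
      using F by (intro continuous_intros) (meson continuous_at_imp_continuous_on has_vector_derivative_continuous)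
    fix s
    have "norm (F u s) \<le> (M + K * norm u) / \<alpha> * exp (\<alpha> * \<bar>s\<bar>)"
    proof (rule exp_weight_bound[OF F0 F _ \<alpha>])
      fix s
      have e: "1 \<le> exp (\<alpha> * \<bar>s\<bar>)" using \<alpha> by simp
      have "norm (f s (curve u s)) \<le> norm (f s x0) + norm (f s (curve u s) - f s x0)"
        by (metis add.commute diff_add_cancel norm_triangle_ineq)
      also have "\<dots> \<le> M + K * (exp (\<alpha> * \<bar>s\<bar>) * norm u)"
        using norm_bounded[of u s] K
        by (intro add_mono bdd order_trans[OF lipK]) (auto simp: curve_def intro!: mult_left_mono)
      also have "\<dots> \<le> M * exp (\<alpha> * \<bar>s\<bar>) + K * (exp (\<alpha> * \<bar>s\<bar>) * norm u)"
        using M e by (simp add: mult_le_cancel_left1)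
      finally show "norm (f s (curve u s)) \<le> (M + K * norm u) * exp (\<alpha> * \<bar>s\<bar>)"
        by (simp add: algebra_simps)
    qed
    then show "norm (exp (- \<alpha> * \<bar>s\<bar>) *\<^sub>R F u s) \<le> (M + K * norm u) / \<alpha>"
      by (simp add: exp_minus field_simps)
  qed
  have "dist (P u) (P w) \<le> 1/2 * dist u w" for u w
  proof (rule dist_bound)
    fix s
    have "norm (F u s - F w s) \<le> K * dist u w / \<alpha> * exp (\<alpha> * \<bar>s\<bar>)"
    proof (rule exp_weight_bound[where F = "\<lambda>s. F u s - F w s", OF _ has_vector_derivative_diff[OF F F] _ \<alpha>])
      fix s
      have "norm (f s (curve u s) - f s (curve w s)) \<le> K * norm (curve u s - curve w s)" by (rule lipK)
      also have "norm (curve u s - curve w s) = exp (\<alpha> * \<bar>s\<bar>) * dist (apply_bcontfun u s) (apply_bcontfun w s)"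
        by (simp add: curve_def dist_norm flip: scaleR_diff_right)
      also have "K * \<dots> \<le> K * (exp (\<alpha> * \<bar>s\<bar>) * dist u w)"
        using K dist_bounded[of u s w] by (intro mult_left_mono) auto
      finally show "norm (f s (curve u s) - f s (curve w s)) \<le> K * dist u w * exp (\<alpha> * \<bar>s\<bar>)"
        by (simp add: algebra_simps)
    qed (simp add: F0)
    then have "exp (- \<alpha> * \<bar>s\<bar>) * norm (F u s - F w s) \<le> K * dist u w / \<alpha>"
      by (simp add: exp_minus field_simps)
    also have "\<dots> = 1/2 * dist u w" using K by (simp add: \<alpha>_def)
    finally show "dist (apply_bcontfun (P u) s) (apply_bcontfun (P w) s) \<le> 1/2 * dist u w"
      by (simp add: apply_P dist_norm flip: scaleR_diff_right)
  qed
  then obtain u where u: "P u = u"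
    using banach_fix_type[of "1/2" P] by auto
  have F_eq: "F u s = exp (\<alpha> * \<bar>s\<bar>) *\<^sub>R apply_bcontfun u s" for s
  proof -
    have "apply_bcontfun u s = exp (- \<alpha> * \<bar>s\<bar>) *\<^sub>R F u s" by (metis u apply_P)
    then show ?thesis by (simp add: exp_minus)
  qed
  have curve_eq: "curve u = (\<lambda>s. x0 + F u s)" by (simp add: curve_def F_eq fun_eq_iff)
  show ?thesis
  proof
    show "x0 + F u 0 = x0" by (simp add: F0)
    show "((\<lambda>s. x0 + F u s) has_vector_derivative f s (x0 + F u s)) (at s)" for s
      using F[of u s] by (auto simp: curve_eq intro!: derivative_eq_intros)
  qed
qed

section \<open>Global flows of bounded Lipschitz fields\<close>

lemma ode_gronwall:
  fixes \<gamma>1 \<gamma>2 :: "real \<Rightarrow> 'a::real_inner"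
  assumes "0 \<le> L"
    and "\<And>s. s \<in> closed_segment 0 t \<Longrightarrow> (\<gamma>1 has_vector_derivative w (\<gamma>1 s)) (at s within closed_segment 0 t)"
    and "\<And>s. s \<in> closed_segment 0 t \<Longrightarrow> (\<gamma>2 has_vector_derivative w (\<gamma>2 s)) (at s within closed_segment 0 t)"
    and "\<And>s. s \<in> closed_segment 0 t \<Longrightarrow> norm (w (\<gamma>1 s) - w (\<gamma>2 s)) \<le> L * norm (\<gamma>1 s - \<gamma>2 s)"
  shows "norm (\<gamma>1 t - \<gamma>2 t) \<le> exp (L * \<bar>t\<bar>) * norm (\<gamma>1 0 - \<gamma>2 0)"
  using gronwall[of L 0 t "\<lambda>s. \<gamma>1 s - \<gamma>2 s" "\<lambda>s. w (\<gamma>1 s) - w (\<gamma>2 s)"] assms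
  by (auto intro!: has_vector_derivative_diff)

lemma closed_segment_0_subset:
  "s \<in> closed_segment 0 t \<Longrightarrow> closed_segment 0 s \<subseteq> closed_segment 0 (t::real)"
  by (auto simp: closed_segment_eq_real_ivl split: if_splits)

lemma abs_le_of_closed_segment_0: "s \<in> closed_segment 0 t \<Longrightarrow> \<bar>s\<bar> \<le> \<bar>t::real\<bar>"
  by (auto simp: closed_segment_eq_real_ivl split: if_splits)

text \<open>A trajectory runs through infinitely many base points, so the Taylor remainder must be
  controlled uniformly in \<open>z\<close>. Uniform continuity of \<open>DV\<close> on a slightly
  larger ball provides this.\<close>

lemma uniform_remainder:
  fixes v :: "'a::euclidean_space \<Rightarrow> 'b::euclidean_space"
  assumes der: "\<And>z. (v has_derivative blinfun_apply (DV z)) (at z)"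
    and cont: "continuous_on UNIV DV" and "0 < \<epsilon>"
  obtains \<delta> where "0 < \<delta>" "\<delta> \<le> 1"
    "\<And>z z'. norm z \<le> R \<Longrightarrow> norm (z' - z) < \<delta> \<Longrightarrow> norm (v z' - v z - DV z (z' - z)) \<le> \<epsilon> * norm (z' - z)"
proof -
  have "uniformly_continuous_on (cball 0 (R + 1)) DV"
    using cont by (intro compact_uniformly_continuous) (auto intro: continuous_on_subset)
  then obtain d where d: "0 < d"
    and dd: "\<And>z z'. z \<in> cball 0 (R + 1) \<Longrightarrow> z' \<in> cball 0 (R + 1) \<Longrightarrow> dist z' z < d \<Longrightarrow> dist (DV z') (DV z) < \<epsilon>"
    unfolding uniformly_continuous_on_def using \<open>0 < \<epsilon>\<close> by metis
  show ?thesis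
  proof
    show "0 < min d 1" "min d 1 \<le> 1" using d by auto
    fix z z' :: 'a assume z: "norm z \<le> R" and z': "norm (z' - z) < min d 1"
    \<comment> \<open>Mean value inequality for \<open>v - DV z\<close>, whose derivative
      \<open>DV y - DV z\<close> is small near \<open>z\<close>.\<close>
    have "norm ((v z' - DV z z') - (v z - DV z z)) \<le> \<epsilon> * norm (z' - z)"
    proof (rule differentiable_bound[where S = "ball z (min d 1)" and f' = "\<lambda>y. blinfun_apply (DV y - DV z)"])
      fix y assume y: "y \<in> ball z (min d 1)"
      show "((\<lambda>y. v y - DV z y) has_derivative blinfun_apply (DV y - DV z)) (at y within ball z (min d 1))"
        using has_derivative_at_withinI[OF der[of y]]
        by (auto intro!: derivative_eq_intros simp: blinfun.diff_left)
      have "norm y \<le> norm z + dist z y" by (metis dist_commute dist_norm norm_triangle_sub)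
      then have "y \<in> cball 0 (R + 1)" using y z by auto
      then have "dist (DV y) (DV z) < \<epsilon>" using dd[of z y] y z by (auto simp: dist_commute)
      then show "onorm (blinfun_apply (DV y - DV z)) \<le> \<epsilon>"
        by (simp add: dist_norm norm_blinfun.rep_eq)
    qed (use d z' in \<open>auto simp: dist_norm norm_minus_commute\<close>)
    then show "norm (v z' - v z - DV z (z' - z)) \<le> \<epsilon> * norm (z' - z)"
      by (simp add: blinfun.diff_right algebra_simps)
  qed
qed

locale global_flow =
  fixes w :: "'a::euclidean_space \<Rightarrow> 'a" and L M :: real
  assumes L_nonneg: "0 \<le> L"
    and lipschitz: "norm (w x - w y) \<le> L * norm (x - y)"
    and bounded: "norm (w x) \<le> M"
begin

text \<open>The choice is of a whole trajectory, independent of \<open>s\<close>, in contrast to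
  \<open>flow\<close>, where it is made separately for each time.\<close>

definition \<Phi> :: "real \<Rightarrow> 'a \<Rightarrow> 'a" where
  "\<Phi> s x = (SOME \<gamma>. \<gamma> 0 = x \<and> (\<forall>s. (\<gamma> has_vector_derivative w (\<gamma> s)) (at s))) s"

lemma continuous_field: "continuous_on UNIV w"
proof (rule lipschitz_on_continuous_on)
  show "L-lipschitz_on UNIV w"
    using lipschitz L_nonneg by (auto simp: lipschitz_on_def dist_norm)
qed

lemma M_nonneg: "0 \<le> M"
  using order_trans[OF norm_ge_zero bounded] .

lemma \<Phi>_solution: "\<Phi> 0 x = x \<and> (\<forall>s. ((\<lambda>s. \<Phi> s x) has_vector_derivative w (\<Phi> s x)) (at s))"
proof -
  have "\<exists>\<gamma>. \<gamma> 0 = x \<and> (\<forall>s. (\<gamma> has_vector_derivative w (\<gamma> s)) (at s))"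
  proof (rule picard_global[of "\<lambda>_. w" L x M])
    show "continuous_on UNIV (\<lambda>s. w (u s))" if "continuous_on UNIV u" for u :: "real \<Rightarrow> 'a"
      using continuous_on_compose2[OF continuous_field that] by simp
  qed (use lipschitz bounded in auto)
  then show ?thesis
    unfolding \<Phi>_def by (rule someI_ex)
qed

lemma \<Phi>_0 [simp]: "\<Phi> 0 x = x"
  using \<Phi>_solution by blast

lemma \<Phi>_deriv: "((\<lambda>s. \<Phi> s x) has_vector_derivative w (\<Phi> s x)) (at s within S)"
  using \<Phi>_solution has_vector_derivative_at_within by blast

text \<open>Only a solution on the segment is assumed, so that local solutions of the original field
  can be identified with \<open>\<Phi>\<close> as long as they stay where the two fields
  agree.\<close>

lemma \<Phi>_unique:
  assumes "\<And>s. s \<in> closed_segment 0 t \<Longrightarrow> (\<gamma> has_vector_derivative w (\<gamma> s)) (at s within closed_segment 0 t)"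
  shows "\<gamma> t = \<Phi> t (\<gamma> 0)"
  using ode_gronwall[of L t \<gamma> w "\<lambda>s. \<Phi> s (\<gamma> 0)"] assms \<Phi>_deriv L_nonneg lipschitz by simp

lemma \<Phi>_add: "\<Phi> (s + r) x = \<Phi> s (\<Phi> r x)"
proof -
  have "((\<lambda>s. \<Phi> (s + r) x) has_vector_derivative w (\<Phi> (s + r) x)) (at s)" for s
  proof -
    have "((\<lambda>s. s + r) has_vector_derivative 1) (at s)"
      by (auto intro!: derivative_eq_intros)
    from vector_diff_chain_within[OF this \<Phi>_deriv] show ?thesis by (simp add: o_def)
  qed
  then show ?thesis
    using \<Phi>_unique[of s "\<lambda>s. \<Phi> (s + r) x"] by (simp add: has_vector_derivative_at_within)
qed

lemma \<Phi>_inverse [simp]: "\<Phi> (- s) (\<Phi> s x) = x" "\<Phi> s (\<Phi> (- s) x) = x"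
  using \<Phi>_add[of "- s" s x] \<Phi>_add[of s "- s" x] by simp_all

lemma \<Phi>_lipschitz: "norm (\<Phi> s x - \<Phi> s y) \<le> exp (L * \<bar>s\<bar>) * norm (x - y)"
  using ode_gronwall[of L s "\<lambda>s. \<Phi> s x" w "\<lambda>s. \<Phi> s y"] \<Phi>_deriv L_nonneg lipschitz by simp

lemma continuous_on_\<Phi>: "continuous_on S (\<Phi> s)"
proof (rule lipschitz_on_continuous_on)
  show "(exp (L * \<bar>s\<bar>))-lipschitz_on S (\<Phi> s)"
    using \<Phi>_lipschitz by (auto simp: lipschitz_on_def dist_norm)
qed

lemma \<Phi>_displacement: "norm (\<Phi> s x - \<Phi> r x) \<le> M * \<bar>s - r\<bar>"
proof -
  have "norm (\<Phi> s x - \<Phi> r x) \<le> M * norm (s - r)"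
  proof (rule differentiable_bound[where S = UNIV and f' = "\<lambda>s h. h *\<^sub>R w (\<Phi> s x)"])
    show "onorm (\<lambda>h. h *\<^sub>R w (\<Phi> u x)) \<le> M" for u
      using bounded[of "\<Phi> u x"] by (intro onorm_le) (auto simp: mult.commute[of M] intro!: mult_left_mono)
  qed (use \<Phi>_deriv in \<open>auto simp: has_vector_derivative_def\<close>)
  then show ?thesis by simp
qed

text \<open>
  The derivative of \<open>\<Phi> t\<close> is the solution operator of the variational equation
  \<open>y' = DV (\<Phi> s x) y\<close>. Clamping the trajectory to a ball keeps its coefficients bounded for
  all times, so that \<open>picard_global\<close> applies.
\<close>

lemma \<Phi>_differentiable:
  assumes der: "\<And>z. (v has_derivative blinfun_apply (DV z)) (at z)"
    and cont: "continuous_on UNIV DV"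
    and eq: "\<And>z. norm z \<le> R + 1 \<Longrightarrow> w z = v z"
    and traj: "\<And>s. s \<in> closed_segment 0 t \<Longrightarrow> norm (\<Phi> s x) \<le> R"
  shows "\<Phi> t differentiable (at x)"
proof -
  have R: "0 \<le> R" using order_trans[OF norm_ge_zero traj[of 0]] by simp
  define A where "A s = DV (closest_point (cball 0 R) (\<Phi> s x))" for s
  have cl: "closest_point (cball 0 R) z \<in> cball 0 R" for z :: 'a
    using R by (intro closest_point_in_set) auto
  have "compact (DV ` cball 0 R)"
    using cont by (intro compact_continuous_image) (auto intro: continuous_on_subset)
  then obtain B where B: "0 < B" "\<And>z. z \<in> cball 0 R \<Longrightarrow> norm (DV z) \<le> B"
    using bounded_pos[of "DV ` cball 0 R"] compact_imp_bounded by auto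
  have A_bound: "norm (A s y) \<le> B * norm y" for s y
    using norm_blinfun[of "A s" y] B(2)[OF cl]
    by (metis A_def mult_right_mono norm_ge_zero order_trans)
  have A_cont: "continuous_on UNIV A"
  proof -
    have "continuous_on UNIV (\<lambda>s. \<Phi> s x)"
      using \<Phi>_deriv by (meson continuous_at_imp_continuous_on has_vector_derivative_continuous)
    moreover have "continuous_on UNIV (closest_point (cball (0::'a) R))"
      using R by (intro continuous_on_closest_point) auto
    ultimately have "continuous_on UNIV (\<lambda>s. closest_point (cball 0 R) (\<Phi> s x))"
      using continuous_on_compose2 by blast
    then show ?thesis unfolding A_def using continuous_on_compose2[OF cont] by simp
  qed
  have "\<exists>\<gamma>. \<gamma> 0 = u \<and> (\<forall>s. (\<gamma> has_vector_derivative A s (\<gamma> s)) (at s))" for u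
  proof (rule picard_global[of "\<lambda>s. blinfun_apply (A s)" B u "B * norm u"])
    show "continuous_on UNIV (\<lambda>s. A s (y s))" if "continuous_on UNIV y" for y
      by (intro continuous_intros A_cont that)
    show "norm (A s y - A s z) \<le> B * norm (y - z)" for s y z
      using A_bound[of s "y - z"] by (simp add: blinfun.diff_right)
  qed (use A_bound in auto)
  then obtain W where W0: "\<And>u. W u 0 = u"
    and W: "\<And>u s. (W u has_vector_derivative A s (W u s)) (at s)"
    by metis
  have W_in: "(W u has_vector_derivative A s (W u s)) (at s within S)" for u s S
    using W has_vector_derivative_at_within by blast
  \<comment> \<open>Solutions of the linear equation with initial value 0 vanish by Gronwall.
    Applied to differences of solutions, this makes \<open>W u t\<close> linear in
    \<open>u\<close>.\<close>
  have vanish: "p t = 0"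
    if "p 0 = 0" "\<And>s. (p has_vector_derivative A s (p s)) (at s within closed_segment 0 t)" for p
    using gronwall[of B 0 t p "\<lambda>s. A s (p s)"] that A_bound B(1) by simp
  have "W (y + z) t - (W y t + W z t) = 0" for y z
    by (rule vanish[where p = "\<lambda>s. W (y + z) s - (W y s + W z s)"])
      (auto simp: W0 blinfun.diff_right blinfun.add_right
        intro!: has_vector_derivative_diff has_vector_derivative_add W_in)
  moreover have "W (c *\<^sub>R y) t - c *\<^sub>R W y t = 0" for c y
    by (rule vanish[where p = "\<lambda>s. W (c *\<^sub>R y) s - c *\<^sub>R W y s"])
      (auto simp: W0 blinfun.diff_right blinfun.scaleR_right
        intro!: has_vector_derivative_diff bounded_linear.has_vector_derivative[OF bounded_linear_scaleR_right] W_in)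
  moreover have "norm (W u t) \<le> norm u * exp (B * \<bar>t\<bar>)" for u
    using gronwall[of B 0 t "W u" "\<lambda>s. A s (W u s)"] W_in A_bound B(1) by (simp add: W0 mult.commute)
  ultimately have lin: "bounded_linear (\<lambda>u. W u t)"
    by (intro bounded_linear_intro[where K = "exp (B * \<bar>t\<bar>)"]) auto
  have "(\<Phi> t has_derivative (\<lambda>u. W u t)) (at x)"
    unfolding has_derivative_at_alt
  proof (intro conjI lin allI impI)
    fix e :: real assume e: "0 < e"
    define c where "c = exp (L * \<bar>t\<bar>)"
    \<comment> \<open>Compensates the factors of the final Gronwall estimate;
      \<open>\<bar>t\<bar> + 1\<close> avoids a division by 0 at t = 0.\<close>
    define \<epsilon> where "\<epsilon> = e / (exp (B * \<bar>t\<bar>) * c * (\<bar>t\<bar> + 1))"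
    have c: "0 < c" by (simp add: c_def)
    have \<epsilon>: "0 < \<epsilon>" unfolding \<epsilon>_def using e c by (simp add: add_nonneg_pos)
    obtain \<delta> where \<delta>: "0 < \<delta>" "\<delta> \<le> 1"
      and rem: "\<And>z z'. norm z \<le> R \<Longrightarrow> norm (z' - z) < \<delta> \<Longrightarrow> norm (v z' - v z - DV z (z' - z)) \<le> \<epsilon> * norm (z' - z)"
      using uniform_remainder[OF der cont \<epsilon>] by blast
    \<comment> \<open>Up to time \<open>t\<close> trajectories separate by at most the factor
      \<open>c\<close>, so the perturbed one stays within \<open>\<delta> \<le> 1\<close> of the
      original and inside the ball of radius \<open>R + 1\<close>, where \<open>w\<close> is
      \<open>v\<close>.\<close>
    have "norm (\<Phi> t y - \<Phi> t x - W (y - x) t) \<le> e * norm (y - x)" if y: "norm (y - x) < \<delta> / c" for y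
    proof -
      define p where "p s = \<Phi> s y - \<Phi> s x - W (y - x) s" for s
      have "norm (p t) \<le> exp (B * \<bar>t\<bar>) * (norm (p 0) + \<epsilon> * (c * norm (y - x)) * \<bar>t\<bar>)"
      proof (rule gronwall[where p' = "\<lambda>s. w (\<Phi> s y) - w (\<Phi> s x) - A s (W (y - x) s)"])
        fix s assume s: "s \<in> closed_segment 0 t"
        show "(p has_vector_derivative w (\<Phi> s y) - w (\<Phi> s x) - A s (W (y - x) s))
          (at s within closed_segment 0 t)"
          unfolding p_def by (intro has_vector_derivative_diff \<Phi>_deriv W_in)
        have close: "norm (\<Phi> s y - \<Phi> s x) \<le> c * norm (y - x)"
          using \<Phi>_lipschitz[of s y x] L_nonneg abs_le_of_closed_segment_0[OF s]
          by (elim order_trans) (auto simp: c_def intro!: mult_right_mono mult_left_mono)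
        also have "\<dots> < \<delta>" using y c by (simp add: field_simps)
        finally have close': "norm (\<Phi> s y - \<Phi> s x) < \<delta>" .
        then have "norm (\<Phi> s y) \<le> R + 1"
          using traj[OF s] \<delta>(2) norm_triangle_sub[of "\<Phi> s y" "\<Phi> s x"] by linarith
        then have w_eq: "w (\<Phi> s y) = v (\<Phi> s y)" "w (\<Phi> s x) = v (\<Phi> s x)"
          using eq traj[OF s] by auto
        have A_eq: "A s = DV (\<Phi> s x)"
          using traj[OF s] by (simp add: A_def closest_point_self)
        \<comment> \<open>The error \<open>p\<close> solves the variational equation up to the
          Taylor remainder of \<open>v\<close>, which is the inhomogeneity in Gronwall's
          estimate.\<close>
        have "w (\<Phi> s y) - w (\<Phi> s x) - A s (W (y - x) s)
          = A s (p s) + (v (\<Phi> s y) - v (\<Phi> s x) - DV (\<Phi> s x) (\<Phi> s y - \<Phi> s x))"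
          by (simp add: w_eq A_eq p_def blinfun.diff_right)
        also have "norm \<dots> \<le> B * norm (p s) + \<epsilon> * norm (\<Phi> s y - \<Phi> s x)"
          by (intro norm_triangle_mono A_bound rem traj[OF s] close')
        also have "\<dots> \<le> B * norm (p s) + \<epsilon> * (c * norm (y - x))"
          using close \<epsilon> B(1) by (intro add_mono mult_left_mono) auto
        finally show "norm (w (\<Phi> s y) - w (\<Phi> s x) - A s (W (y - x) s))
          \<le> B * norm (p s) + \<epsilon> * (c * norm (y - x))" .
      qed (use B \<epsilon> c in auto)
      also have "p 0 = 0" by (simp add: p_def W0)
      also have "exp (B * \<bar>t\<bar>) * (norm (0::'a) + \<epsilon> * (c * norm (y - x)) * \<bar>t\<bar>)
        \<le> exp (B * \<bar>t\<bar>) * (\<epsilon> * (c * norm (y - x)) * (\<bar>t\<bar> + 1))"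
        using \<epsilon> c by (auto intro!: mult_left_mono)
      also have "\<dots> = (\<epsilon> * (exp (B * \<bar>t\<bar>) * c * (\<bar>t\<bar> + 1))) * norm (y - x)"
        by (simp add: mult_ac)
      also have "\<epsilon> * (exp (B * \<bar>t\<bar>) * c * (\<bar>t\<bar> + 1)) = e"
        unfolding \<epsilon>_def using c by (simp add: add_nonneg_eq_0_iff)
      finally show ?thesis by (simp add: p_def)
    qed
    then show "\<exists>d>0. \<forall>y. norm (y - x) < d \<longrightarrow> norm (\<Phi> t y - \<Phi> t x - W (y - x) t) \<le> e * norm (y - x)"
      using \<delta>(1) c by (intro exI[of _ "\<delta> / c"]) auto
  qed
  then show ?thesis by (auto simp: differentiable_def)
qed

end

section \<open>The local flow of a continuously differentiable field\<close>

lemma partial_deriv_eq: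
  fixes f :: "real ^ 'n \<Rightarrow> real"
  assumes "(f has_derivative f') (at x)"
  shows "partial_deriv i f x = f' (axis i 1)"
proof -
  have "((\<lambda>h. x + h *\<^sub>R axis i 1) has_derivative (\<lambda>h. h *\<^sub>R axis i (1::real))) (at 0)"
    by (auto intro!: derivative_eq_intros)
  moreover have "(f has_derivative f') (at (x + 0 *\<^sub>R axis i 1))" using assms by simp
  ultimately have "((\<lambda>h. f (x + h *\<^sub>R axis i 1)) has_derivative (\<lambda>h. f' (h *\<^sub>R axis i (1::real)))) (at 0)"
    by (rule has_derivative_compose)
  moreover have "f' (h *\<^sub>R axis i 1) = f' (axis i 1) * h" for h
    using linear_scale[OF has_derivative_linear[OF assms]] by simp
  ultimately have "((\<lambda>h. f (x + h *\<^sub>R axis i 1)) has_real_derivative f' (axis i 1)) (at 0)"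
    by (simp add: has_field_derivative_def)
  then show ?thesis unfolding partial_deriv_def by (rule DERIV_imp_deriv)
qed

lemma has_derivative_partial_deriv:
  fixes f :: "real ^ 'n \<Rightarrow> real"
  assumes "f differentiable (at x)"
  shows "(f has_derivative (\<lambda>u. \<Sum>i\<in>UNIV. u $ i * partial_deriv i f x)) (at x)"
proof -
  obtain f' where f': "(f has_derivative f') (at x)" using assms by (auto simp: differentiable_def)
  have "f' = (\<lambda>u. \<Sum>i\<in>UNIV. u $ i * partial_deriv i f x)"
  proof
    fix u
    have "f' u = f' (\<Sum>i\<in>UNIV. (u $ i) *\<^sub>R axis i 1)"
      using basis_expansion[of u] by (simp add: scalar_mult_eq_scaleR)
    also have "\<dots> = (\<Sum>i\<in>UNIV. u $ i * f' (axis i 1))"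
      by (simp add: linear_sum[OF has_derivative_linear[OF f']] linear_scale[OF has_derivative_linear[OF f']])
    finally show "f' u = (\<Sum>i\<in>UNIV. u $ i * partial_deriv i f x)" by (simp add: partial_deriv_eq[OF f'])
  qed
  then show ?thesis using f' by simp
qed

lemma C1_on_iff:
  "C1_on S f \<longleftrightarrow> (\<forall>x\<in>S. f differentiable (at x)) \<and> (\<forall>i. continuous_on S (partial_deriv i f))"
  by (simp only: One_nat_def Ck_on.simps)

lemma C1_on_differentiable: "C1_on S f \<Longrightarrow> x \<in> S \<Longrightarrow> f differentiable (at x)"
  by (simp add: C1_on_iff del: Ck_on.simps One_nat_def)

lemma C1_on_continuous: "C1_on S f \<Longrightarrow> continuous_on S f"
  by (meson C1_on_differentiable continuous_at_imp_continuous_on differentiable_imp_continuous_within)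

text \<open>Packaging the derivative as a \<open>blinfun\<close> gives it an operator norm, in which
  it is bounded and uniformly continuous on balls. In finite dimension, continuity in that norm
  reduces to the matrix entries.\<close>

lemma C1_field_derivative:
  fixes v :: "real ^ 'n \<Rightarrow> real ^ 'n"
  assumes "\<forall>i. C1_on UNIV (\<lambda>x. v x $ i)"
  obtains DV where "\<And>z. (v has_derivative blinfun_apply (DV z)) (at z)" "continuous_on UNIV DV"
proof -
  define D where "D z u = (\<chi> j. \<Sum>i\<in>UNIV. u $ i * partial_deriv i (\<lambda>x. v x $ j) z)" for z and u :: "real ^ 'n"
  have der: "(v has_derivative D z) (at z)" for z
  proof (subst has_derivative_componentwise_within, intro ballI)
    fix b :: "real ^ 'n" assume "b \<in> Basis"
    then obtain j where "b = axis j 1" by (auto simp: Basis_vec_def)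
    moreover have "(\<lambda>x. v x $ j) differentiable (at z)"
      using C1_on_differentiable assms by blast
    ultimately show "((\<lambda>x. v x \<bullet> b) has_derivative (\<lambda>x. D z x \<bullet> b)) (at z)"
      using has_derivative_partial_deriv by (simp add: inner_axis D_def)
  qed
  have apply_D: "blinfun_apply (Blinfun (D z)) = D z" for z
    using der has_derivative_bounded_linear bounded_linear_Blinfun_apply by blast
  show ?thesis
  proof
    show "(v has_derivative blinfun_apply (Blinfun (D z))) (at z)" for z
      using der by (simp add: apply_D)
    show "continuous_on UNIV (\<lambda>z. Blinfun (D z))"
      using assms unfolding C1_on_iff
      by (intro continuous_on_blinfun_componentwise) (auto simp: apply_D D_def intro!: continuous_intros)
  qed
qed

text \<open>Composing with the closest-point projection onto a ball, which is 1-Lipschitz, leaves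
  \<open>v\<close> untouched inside and makes it bounded and Lipschitz everywhere. The result may
  fail to be differentiable on the sphere, so derivatives are always taken of \<open>v\<close>
  itself.\<close>

lemma clamped_field_global_flow:
  fixes v :: "'a::euclidean_space \<Rightarrow> 'a"
  assumes der: "\<And>z. (v has_derivative blinfun_apply (DV z)) (at z)"
    and cont: "continuous_on UNIV DV" and R: "0 \<le> R"
  obtains w L M where "global_flow w L M" "\<And>z. norm z \<le> R \<Longrightarrow> w z = v z"
proof -
  define w where "w z = v (closest_point (cball 0 R) z)" for z
  have cl: "closest_point (cball 0 R) z \<in> cball 0 R" for z :: 'a
    using R by (intro closest_point_in_set) auto
  have "compact (DV ` cball 0 R)"
    using cont by (intro compact_continuous_image) (auto intro: continuous_on_subset)
  then obtain L where L: "0 < L" "\<And>z. z \<in> cball 0 R \<Longrightarrow> norm (DV z) \<le> L"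
    using bounded_pos[of "DV ` cball 0 R"] compact_imp_bounded by auto
  have "continuous_on (cball 0 R) v"
    using der by (meson continuous_at_imp_continuous_on has_derivative_continuous)
  then have "bounded (v ` cball 0 R)"
    by (intro compact_imp_bounded compact_continuous_image) auto
  then obtain M where M: "\<And>z. z \<in> cball 0 R \<Longrightarrow> norm (v z) \<le> M"
    by (auto simp only: bounded_iff ball_simps)
  show ?thesis
  proof
    show "global_flow w L M"
    proof
      fix x y
      have "norm (w x - w y) \<le> L * norm (closest_point (cball 0 R) x - closest_point (cball 0 R) y)"
        unfolding w_def
      proof (rule differentiable_bound[where S = "cball 0 R" and f' = "\<lambda>z. blinfun_apply (DV z)"])
        show "onorm (blinfun_apply (DV z)) \<le> L" if "z \<in> cball 0 R" for z
          using L(2)[OF that] by (simp add: norm_blinfun.rep_eq)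
      qed (rule convex_cball der cl | rule has_derivative_at_withinI)+
      also have "\<dots> \<le> L * norm (x - y)"
        using closest_point_lipschitz[of "cball 0 R" x y] L(1) R
        by (intro mult_left_mono) (auto simp: dist_norm)
      finally show "norm (w x - w y) \<le> L * norm (x - y)" .
      show "norm (w x) \<le> M" unfolding w_def by (rule M[OF cl])
    qed (use L in simp)
    show "w z = v z" if "norm z \<le> R" for z
      using that by (simp add: w_def closest_point_self)
  qed
qed

text \<open>Such an \<open>r\<close> lies between \<open>t\<close> and \<open>s\<close>, whether
  \<open>s\<close> overshoots \<open>t\<close> or lies on the other side of 0. This splits a
  trajectory up to \<open>s\<close> into the part controlled up to \<open>t\<close> and a short
  rest.\<close>

lemma abs_diff_le_of_closed_segment_0:
  "r \<in> closed_segment 0 s \<Longrightarrow> r \<notin> closed_segment 0 t \<Longrightarrow> \<bar>r - t\<bar> \<le> \<bar>s - t::real\<bar>"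
  by (auto simp: closed_segment_eq_real_ivl split: if_splits)

section \<open>Uniqueness, bounds and short continuation of local solutions\<close>

locale C1_field =
  fixes v :: "real ^ 'n \<Rightarrow> real ^ 'n" and DV
  assumes v_deriv: "\<And>z. (v has_derivative blinfun_apply (DV z)) (at z)"
    and DV_cont: "continuous_on UNIV DV"
begin

text \<open>\<open>v\<close> is only locally Lipschitz, but on the compact segment both solutions
  stay in one ball. Hence both solve the field clamped to that ball, where Gronwall applies
  globally.\<close>

lemma solution_unique:
  assumes "solution_upto v x t \<gamma>1" "solution_upto v x t \<gamma>2"
  shows "\<gamma>1 t = \<gamma>2 t"
proof -
  let ?seg = "closed_segment 0 t"
  have "\<exists>R. 0 \<le> R \<and> (\<forall>s\<in>?seg. norm (\<gamma> s) \<le> R)" if "solution_upto v x t \<gamma>" for \<gamma>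
  proof -
    have "continuous_on ?seg \<gamma>"
      using that unfolding solution_upto_def
      by (meson continuous_on_eq_continuous_within has_vector_derivative_continuous)
    then have "compact (\<gamma> ` ?seg)" by (intro compact_continuous_image) auto
    then show ?thesis using bounded_pos[of "\<gamma> ` ?seg"] compact_imp_bounded less_imp_le by auto
  qed
  from this[OF assms(1)] this[OF assms(2)] obtain R1 R2 where R: "0 \<le> R1"
    "\<And>s. s \<in> ?seg \<Longrightarrow> norm (\<gamma>1 s) \<le> R1" "\<And>s. s \<in> ?seg \<Longrightarrow> norm (\<gamma>2 s) \<le> R2"
    by blast
  then have "0 \<le> max R1 R2" by simp
  from clamped_field_global_flow[OF v_deriv DV_cont this]
  obtain w L M where w: "global_flow w L M" "\<And>z. norm z \<le> max R1 R2 \<Longrightarrow> w z = v z"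
    by blast
  interpret global_flow w L M by (rule w)
  have "w (\<gamma>1 s) = v (\<gamma>1 s)" "w (\<gamma>2 s) = v (\<gamma>2 s)" if "s \<in> ?seg" for s
    using R(2,3)[OF that] w(2) by simp_all
  then show ?thesis
    using \<Phi>_unique[of t \<gamma>1] \<Phi>_unique[of t \<gamma>2] assms by (simp add: solution_upto_def)
qed

lemma flow_eq: "solution_upto v x t \<gamma> \<Longrightarrow> flow v t x = \<gamma> t"
  unfolding flow_def by (rule solution_unique[OF someI[of "solution_upto v x t"]])

lemma solution_upto_\<Phi>:
  assumes "global_flow w L M"
    and "\<And>s. s \<in> closed_segment 0 t \<Longrightarrow> w (global_flow.\<Phi> w s x) = v (global_flow.\<Phi> w s x)"
  shows "solution_upto v x t (\<lambda>s. global_flow.\<Phi> w s x)"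
proof -
  interpret global_flow w L M by (rule assms)
  show ?thesis
    unfolding solution_upto_def
  proof (intro conjI ballI)
    fix s assume "s \<in> closed_segment 0 t"
    show "((\<lambda>s. \<Phi> s x) has_vector_derivative v (\<Phi> s x)) (at s within closed_segment 0 t)"
      unfolding assms(2)[OF \<open>s \<in> closed_segment 0 t\<close>, symmetric] by (rule \<Phi>_deriv)
  qed (rule \<Phi>_0)
qed

text \<open>
  Solutions starting in a compact set stay in a common ball: near each initial point they are
  trajectories of one clamped field, hence stay within distance 1 of the given solution.
\<close>

lemma solutions_bounded:
  assumes "compact K" and "\<And>x. x \<in> K \<Longrightarrow> flow_defined v t x"
  obtains R where "0 \<le> R"
    "\<And>x. x \<in> K \<Longrightarrow> \<exists>\<gamma>. solution_upto v x t \<gamma> \<and> (\<forall>s\<in>closed_segment 0 t. norm (\<gamma> s) \<le> R)"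
proof -
  define P where "P R x \<longleftrightarrow> (\<exists>\<gamma>. solution_upto v x t \<gamma> \<and> (\<forall>s\<in>closed_segment 0 t. norm (\<gamma> s) \<le> R))" for R x
  have "\<exists>R r. 0 \<le> R \<and> 0 < r \<and> (\<forall>x. x \<in> ball x0 r \<longrightarrow> P R x)" if x0: "x0 \<in> K" for x0
  proof -
    obtain \<gamma>0 where \<gamma>0: "solution_upto v x0 t \<gamma>0" using assms(2)[OF x0] by (auto simp: flow_defined_def)
    have "continuous_on (closed_segment 0 t) \<gamma>0"
      using \<gamma>0 unfolding solution_upto_def
      by (meson continuous_on_eq_continuous_within has_vector_derivative_continuous)
    then have "compact (\<gamma>0 ` closed_segment 0 t)" by (intro compact_continuous_image) auto
    then obtain R0 where R0: "0 < R0" "\<And>s. s \<in> closed_segment 0 t \<Longrightarrow> norm (\<gamma>0 s) \<le> R0"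
      using bounded_pos[of "\<gamma>0 ` closed_segment 0 t"] compact_imp_bounded by auto
    have "0 \<le> R0 + 1" using R0(1) by simp
    from clamped_field_global_flow[OF v_deriv DV_cont this]
    obtain w L M where w: "global_flow w L M" "\<And>z. norm z \<le> R0 + 1 \<Longrightarrow> w z = v z"
      by blast
    interpret global_flow w L M by (rule w)
    have \<Phi>_x0: "\<Phi> s x0 = \<gamma>0 s" if s: "s \<in> closed_segment 0 t" for s
    proof -
      have "(\<gamma>0 has_vector_derivative w (\<gamma>0 r)) (at r within closed_segment 0 s)" if r: "r \<in> closed_segment 0 s" for r
      proof -
        have r': "r \<in> closed_segment 0 t" using r closed_segment_0_subset[OF s] by blast
        then have "w (\<gamma>0 r) = v (\<gamma>0 r)" using R0(2)[OF r'] w(2) by simp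
        moreover have "(\<gamma>0 has_vector_derivative v (\<gamma>0 r)) (at r within closed_segment 0 s)"
          using \<gamma>0 r' closed_segment_0_subset[OF s]
          unfolding solution_upto_def by (blast intro: has_vector_derivative_within_subset)
        ultimately show ?thesis by simp
      qed
      then show ?thesis using \<Phi>_unique[of s \<gamma>0] \<gamma>0 by (simp add: solution_upto_def)
    qed
    \<comment> \<open>Up to time \<open>t\<close> the flow magnifies distances by at most
      \<open>exp (L * \<bar>t\<bar>)\<close>, so starting this close means staying within distance
      1, where the clamp is not felt.\<close>
    have "P (R0 + 1) x" if x: "x \<in> ball x0 (exp (- (L * \<bar>t\<bar>)))" for x
    proof -
      have bd: "norm (\<Phi> s x) \<le> R0 + 1" if s: "s \<in> closed_segment 0 t" for s
      proof -
        have "norm (\<Phi> s x - \<Phi> s x0) \<le> exp (L * \<bar>s\<bar>) * norm (x - x0)" by (rule \<Phi>_lipschitz)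
        also have "\<dots> \<le> exp (L * \<bar>t\<bar>) * norm (x - x0)"
          using abs_le_of_closed_segment_0[OF s] L_nonneg by (intro mult_right_mono) (auto intro: mult_left_mono)
        also have "\<dots> \<le> exp (L * \<bar>t\<bar>) * exp (- (L * \<bar>t\<bar>))"
          using x by (intro mult_left_mono) (auto simp: dist_norm norm_minus_commute)
        also have "\<dots> = 1" by (simp flip: exp_add)
        finally have "norm (\<Phi> s x - \<Phi> s x0) \<le> 1" .
        then show ?thesis
          using R0(2)[OF s] \<Phi>_x0[OF s] norm_triangle_sub[of "\<Phi> s x" "\<Phi> s x0"] by simp
      qed
      have "solution_upto v x t (\<lambda>s. \<Phi> s x)"
        by (rule solution_upto_\<Phi>[OF w(1)]) (rule w(2)[OF bd])
      then show ?thesis unfolding P_def by (intro exI[of _ "\<lambda>s. \<Phi> s x"] conjI ballI bd)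
    qed
    then show ?thesis
      using R0(1) by (intro exI[of _ "R0 + 1"] exI[of _ "exp (- (L * \<bar>t\<bar>))"]) auto
  qed
  note local = this
  \<comment> \<open>Bound and radius are paired so that a single application of choice yields
    both.\<close>
  have "\<forall>x0\<in>K. \<exists>q. 0 \<le> fst q \<and> 0 < snd q \<and> (\<forall>x. x \<in> ball x0 (snd q) \<longrightarrow> P (fst q) x)"
  proof
    fix x0 assume "x0 \<in> K"
    from local[OF this] obtain R r where "0 \<le> R \<and> 0 < r \<and> (\<forall>x. x \<in> ball x0 r \<longrightarrow> P R x)" by blast
    then show "\<exists>q. 0 \<le> fst q \<and> 0 < snd q \<and> (\<forall>x. x \<in> ball x0 (snd q) \<longrightarrow> P (fst q) x)"
      by (intro exI[of _ "(R, r)"]) simp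
  qed
  from bchoice[OF this] obtain q where
    "\<forall>x0\<in>K. 0 \<le> fst (q x0) \<and> 0 < snd (q x0) \<and> (\<forall>x. x \<in> ball x0 (snd (q x0)) \<longrightarrow> P (fst (q x0)) x)" ..
  then have q: "0 \<le> fst (q x0)" "0 < snd (q x0)" "\<And>x. x \<in> ball x0 (snd (q x0)) \<Longrightarrow> P (fst (q x0)) x"
    if "x0 \<in> K" for x0
    using that by blast+
  define R r where "R x0 = fst (q x0)" and "r x0 = snd (q x0)" for x0
  have Rr: "0 \<le> R x0" "0 < r x0" "\<And>x. x \<in> ball x0 (r x0) \<Longrightarrow> P (R x0) x" if "x0 \<in> K" for x0
    using q[OF that] unfolding R_def r_def by blast+
  have cover: "K \<subseteq> (\<Union>x0\<in>K. ball x0 (r x0))"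
  proof
    fix x assume "x \<in> K"
    then show "x \<in> (\<Union>x0\<in>K. ball x0 (r x0))" using Rr(2)[of x] by (intro UN_I[of x]) auto
  qed
  obtain C where C: "C \<subseteq> K" "finite C" "K \<subseteq> (\<Union>x0\<in>C. ball x0 (r x0))"
    by (rule compactE_image[OF assms(1) _ cover]) (rule open_ball)
  show ?thesis
  proof
    \<comment> \<open>The sum stands in for the maximum over the finite subcover and also makes
      sense when \<open>K\<close> is empty.\<close>
    show "0 \<le> (\<Sum>x0\<in>C. R x0)" using Rr(1) C(1) by (intro sum_nonneg) blast
    fix x assume "x \<in> K"
    then obtain x0 where x0: "x0 \<in> C" "x \<in> ball x0 (r x0)" using C by auto
    then have "x0 \<in> K" using C(1) by blast
    from Rr(3)[OF this x0(2)] have "P (R x0) x" .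
    moreover have "R x0 \<le> (\<Sum>x0\<in>C. R x0)" using Rr(1) C(1,2) x0 by (intro member_le_sum) blast+
    ultimately show "\<exists>\<gamma>. solution_upto v x t \<gamma> \<and> (\<forall>s\<in>closed_segment 0 t. norm (\<gamma> s) \<le> (\<Sum>x0\<in>C. R x0))"
      unfolding P_def by (meson order_trans)
  qed
qed

text \<open>Existence is assumed at time \<open>t\<close> alone. The solutions up to
  \<open>t\<close> stay in a ball, the clamped field goes on for all times, and its trajectories
  need a definite time to leave a larger ball; until then they solve the original equation. The
  margin \<open>\<delta>\<close> is the same for all of \<open>K\<close>.\<close>

lemma flow_near_time:
  assumes "compact K" and "\<And>x. x \<in> K \<Longrightarrow> flow_defined v t x"
  obtains w L M R \<delta> where "global_flow w L M" "\<And>z. norm z \<le> R + 1 \<Longrightarrow> w z = v z" "0 < \<delta>"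
    "\<And>x s. x \<in> K \<Longrightarrow> s \<in> closed_segment 0 t \<Longrightarrow> norm (global_flow.\<Phi> w s x) \<le> R"
    "\<And>x s. x \<in> K \<Longrightarrow> \<bar>s - t\<bar> \<le> \<delta> \<Longrightarrow> flow v s x = global_flow.\<Phi> w s x"
proof -
  obtain R where R: "0 \<le> R"
    "\<And>x. x \<in> K \<Longrightarrow> \<exists>\<gamma>. solution_upto v x t \<gamma> \<and> (\<forall>s\<in>closed_segment 0 t. norm (\<gamma> s) \<le> R)"
    using solutions_bounded[OF assms] by blast
  have "0 \<le> R + 2" using R(1) by simp
  from clamped_field_global_flow[OF v_deriv DV_cont this]
  obtain w L M where w: "global_flow w L M" "\<And>z. norm z \<le> R + 2 \<Longrightarrow> w z = v z"
    by blast
  interpret global_flow w L M by (rule w)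
  \<comment> \<open>Points move with speed at most \<open>M\<close>, hence by at most 1 in this
    time; the added 1 covers \<open>M = 0\<close>.\<close>
  define \<delta> where "\<delta> = 1 / (M + 1)"
  have \<delta>: "0 < \<delta>" "M * \<delta> \<le> 1" using M_nonneg by (auto simp: \<delta>_def)
  have bound: "norm (\<Phi> s x) \<le> R" if x: "x \<in> K" and s: "s \<in> closed_segment 0 t" for x s
  proof -
    obtain \<gamma> where \<gamma>: "solution_upto v x t \<gamma>" "\<And>s. s \<in> closed_segment 0 t \<Longrightarrow> norm (\<gamma> s) \<le> R"
      using R(2)[OF x] by blast
    have "(\<gamma> has_vector_derivative w (\<gamma> r)) (at r within closed_segment 0 s)" if r: "r \<in> closed_segment 0 s" for r
    proof -
      have r': "r \<in> closed_segment 0 t" using r closed_segment_0_subset[OF s] by blast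
      then have "w (\<gamma> r) = v (\<gamma> r)" using \<gamma>(2)[OF r'] w(2) by simp
      moreover have "(\<gamma> has_vector_derivative v (\<gamma> r)) (at r within closed_segment 0 s)"
        using \<gamma>(1) r' closed_segment_0_subset[OF s]
        unfolding solution_upto_def by (blast intro: has_vector_derivative_within_subset)
      ultimately show ?thesis by simp
    qed
    then have "\<gamma> s = \<Phi> s x" using \<Phi>_unique[of s \<gamma>] \<gamma>(1) by (simp add: solution_upto_def)
    then show ?thesis using \<gamma>(2)[OF s] by simp
  qed
  have near: "norm (\<Phi> s x) \<le> R + 1" if x: "x \<in> K" and s: "\<bar>s - t\<bar> \<le> \<delta>" for x s
  proof -
    have "norm (\<Phi> s x - \<Phi> t x) \<le> M * \<delta>"
      using \<Phi>_displacement[of s x t] s M_nonneg by (meson mult_left_mono order_trans)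
    then show ?thesis
      using bound[OF x, of t] \<delta>(2) norm_triangle_sub[of "\<Phi> s x" "\<Phi> t x"] by simp
  qed
  show ?thesis
  proof (rule that[of w L M R \<delta>])
    fix x s assume x: "x \<in> K" and s: "\<bar>s - t\<bar> \<le> \<delta>"
    have "norm (\<Phi> r x) \<le> R + 1" if "r \<in> closed_segment 0 s" for r
    proof (cases "r \<in> closed_segment 0 t")
      case False
      have "\<bar>r - t\<bar> \<le> \<delta>"
        by (rule order_trans[OF abs_diff_le_of_closed_segment_0[OF that False] s])
      then show ?thesis by (rule near[OF x])
    qed (use bound[OF x, of r] in auto)
    then have "solution_upto v x s (\<lambda>s. \<Phi> s x)"
      by (intro solution_upto_\<Phi>[OF w(1)] w(2)) force
    then show "flow v s x = \<Phi> s x" by (rule flow_eq)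
  qed (use w \<delta> bound in simp_all)
qed

text \<open>\<open>flow v s\<close> inherits injectivity on the support from the invertible
  \<open>\<Phi> s\<close>, so \<open>inv_into\<close> is \<open>\<Phi> (- s)\<close> on the image.
  Off the image, \<open>\<Phi> (- s) y\<close> lies outside the support, so the extension by zero is
  automatic.\<close>

lemma transport_near_time:
  assumes "compact (supp \<Delta>)" and "\<And>x. x \<in> supp \<Delta> \<Longrightarrow> flow_defined v t x"
  obtains w L M R \<delta> where "global_flow w L M" "\<And>z. norm z \<le> R + 1 \<Longrightarrow> w z = v z" "0 < \<delta>"
    "\<And>x s. x \<in> supp \<Delta> \<Longrightarrow> s \<in> closed_segment 0 t \<Longrightarrow> norm (global_flow.\<Phi> w s x) \<le> R"
    "\<And>x. x \<in> supp \<Delta> \<Longrightarrow> flow v t x = global_flow.\<Phi> w t x"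
    "\<And>s. \<bar>s - t\<bar> \<le> \<delta> \<Longrightarrow> transport v \<Delta> s = (\<lambda>y. \<Delta> (global_flow.\<Phi> w (- s) y))"
proof (rule flow_near_time[OF assms])
  fix w L M R \<delta>
  assume w: "global_flow w L M" "\<And>z. norm z \<le> R + 1 \<Longrightarrow> w z = v z" "0 < \<delta>"
    "\<And>x s. x \<in> supp \<Delta> \<Longrightarrow> s \<in> closed_segment 0 t \<Longrightarrow> norm (global_flow.\<Phi> w s x) \<le> R"
    and flow: "\<And>x s. x \<in> supp \<Delta> \<Longrightarrow> \<bar>s - t\<bar> \<le> \<delta> \<Longrightarrow> flow v s x = global_flow.\<Phi> w s x"
  interpret global_flow w L M by (rule w)
  have "transport v \<Delta> s = (\<lambda>y. \<Delta> (\<Phi> (- s) y))" if s: "\<bar>s - t\<bar> \<le> \<delta>" for s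
  proof
    fix y
    have img: "flow v s ` supp \<Delta> = \<Phi> s ` supp \<Delta>" using flow s by auto
    have inj: "inj_on (flow v s) (supp \<Delta>)"
    proof (rule inj_onI)
      fix x y assume "x \<in> supp \<Delta>" "y \<in> supp \<Delta>" "flow v s x = flow v s y"
      then have "\<Phi> (- s) (\<Phi> s x) = \<Phi> (- s) (\<Phi> s y)" using flow s by simp
      then show "x = y" by simp
    qed
    show "transport v \<Delta> s y = \<Delta> (\<Phi> (- s) y)"
    proof (cases "\<Phi> (- s) y \<in> supp \<Delta>")
      case True
      then have "flow v s (\<Phi> (- s) y) = y" using flow s by simp
      then show ?thesis
        using imageI[OF True, of "flow v s"] inv_into_f_f[OF inj True] by (simp add: transport_def)
    next
      case False
      then have "y \<notin> flow v s ` supp \<Delta>" unfolding img by auto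
      moreover have "\<Delta> (\<Phi> (- s) y) = 0"
        using False closure_subset[of "{x. \<Delta> x \<noteq> 0}"] unfolding supp_def by (simp add: subset_iff) blast
      ultimately show ?thesis by (simp add: transport_def)
    qed
  qed
  moreover have "flow v t x = \<Phi> t x" if "x \<in> supp \<Delta>" for x
    using flow[OF that, of t] w(3) by simp
  ultimately show ?thesis by (intro that[OF w]) blast+
qed

end

section \<open>Differentiating integrals of transported functions\<close>

lemma lborel_integral_translation:
  fixes f :: "'a::euclidean_space \<Rightarrow> real"
  assumes "f \<in> borel_measurable borel"
  shows "(LBINT x. f (x + c)) = (LBINT x. f x)"
proof -
  have "(LBINT x. f x) = (\<integral>x. f x \<partial>distr lborel borel ((+) c))"
    by (simp add: lborel_distr_plus)
  also have "\<dots> = (LBINT x. f (c + x))"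
    using assms by (intro integral_distr) auto
  finally show ?thesis by (simp add: add.commute)
qed

text \<open>Each difference quotient in direction \<open>e\<close> integrates to 0 by translation
  invariance, and the mean value theorem bounds it by \<open>C\<close>, so dominated convergence
  passes to the limit. The derivative is measurable as a pointwise limit of the quotients.\<close>

lemma integral_directional_derivative_eq_0:
  fixes f :: "'a::euclidean_space \<Rightarrow> real"
  assumes der: "\<And>x. (f has_derivative f' x) (at x)"
    and bound: "\<And>x. \<bar>f' x e\<bar> \<le> C"
    and K: "bounded K" and vanish: "\<And>x. x \<notin> K \<Longrightarrow> f x = 0"
  shows "integrable lborel (\<lambda>x. f' x e)" "(LBINT x. f' x e) = 0"
proof -
  obtain R where R: "\<And>x. x \<in> K \<Longrightarrow> norm x \<le> R" using K by (auto simp: bounded_iff)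
  have cont: "continuous_on UNIV f"
    using der by (meson continuous_at_imp_continuous_on has_derivative_continuous)
  then have meas: "f \<in> borel_measurable borel" by (rule borel_measurable_continuous_onI)
  have f_int: "integrable lborel f"
  proof -
    have "integrable lborel (\<lambda>x. indicator (cball 0 R) x *\<^sub>R f x)"
      by (rule borel_integrable_compact) (auto intro: continuous_on_subset[OF cont])
    also have "(\<lambda>x. indicator (cball 0 R) x *\<^sub>R f x) = f"
      using R vanish by (fastforce simp: indicator_def)
    finally show ?thesis .
  qed
  define h where "h k = inverse (real (Suc k))" for k
  define q where "q k x = (f (x + h k *\<^sub>R e) - f x) / h k" for k x
  have h: "0 < h k" "h k \<le> 1" for k by (auto simp: h_def field_simps)
  have line: "((\<lambda>t. f (x + t *\<^sub>R e)) has_real_derivative f' (x + t *\<^sub>R e) e) (at t)" for x t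
  proof -
    have "((\<lambda>t. x + t *\<^sub>R e) has_derivative (\<lambda>t. t *\<^sub>R e)) (at t)" by (auto intro!: derivative_eq_intros)
    from has_derivative_compose[OF this der]
    show ?thesis
      by (simp add: has_field_derivative_def linear_scale[OF has_derivative_linear[OF der]] mult.commute[of _ "f' _ e"])
  qed
  have lim: "(\<lambda>k. q k x) \<longlonglongrightarrow> f' x e" for x
  proof -
    have "((\<lambda>t. (f (x + t *\<^sub>R e) - f x) / t) \<longlongrightarrow> f' x e) (at 0)"
      using line[of x 0] by (simp add: has_field_derivative_iff)
    moreover have "filterlim h (at 0) sequentially"
      unfolding filterlim_at h_def using LIMSEQ_inverse_real_of_nat by auto
    ultimately show ?thesis unfolding q_def by (rule filterlim_compose)
  qed
  \<comment> \<open>As \<open>h k \<le> 1\<close>, the shift moves points by at most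
    \<open>norm e\<close>, so one enlarged ball contains the supports of all quotients.\<close>
  have q_bound: "\<bar>q k x\<bar> \<le> C * indicator (cball 0 (R + norm e)) x" for k x
  proof (cases "norm x \<le> R + norm e")
    case True
    have "norm (f (x + h k *\<^sub>R e) - f (x + 0 *\<^sub>R e)) \<le> C * norm (h k - 0)"
      by (rule field_differentiable_bound[where S = UNIV and f' = "\<lambda>t. f' (x + t *\<^sub>R e) e"])
        (use line bound in auto)
    then show ?thesis using True h[of k] by (simp add: q_def field_simps)
  next
    case False
    have "norm x \<le> norm (x + h k *\<^sub>R e) + norm (h k *\<^sub>R e)"
      by (metis add_diff_cancel_right' norm_triangle_ineq4)
    moreover have "norm (h k *\<^sub>R e) \<le> norm e"
      using h[of k] by (simp add: mult_left_le_one_le)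
    ultimately have "R < norm (x + h k *\<^sub>R e)" using False by linarith
    moreover have "R < norm x" using False norm_ge_zero[of e] by linarith
    ultimately have "x \<notin> K" "x + h k *\<^sub>R e \<notin> K" using R by fastforce+
    then show ?thesis using False by (simp add: q_def vanish)
  qed
  have meas_shift: "(\<lambda>x. f (x + c)) \<in> borel_measurable borel" for c using meas by measurable
  have shift_int: "integrable lborel (\<lambda>x. f (x + c))" for c
  proof -
    have "integrable (distr lborel borel ((+) c)) f" using f_int by (simp add: lborel_distr_plus)
    then show ?thesis using meas by (subst (asm) integrable_distr_eq) (auto simp: add.commute)
  qed
  have q_meas: "q k \<in> borel_measurable lborel" for k
    unfolding q_def using meas_shift meas by simp
  have f'_meas: "(\<lambda>x. f' x e) \<in> borel_measurable lborel"
    using lim q_meas by (rule borel_measurable_LIMSEQ_real)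
  have "integrable lborel (indicat_real (cball (0::'a) (R + norm e)))"
    using emeasure_bounded_finite[of "cball (0::'a) (R + norm e)"] by (intro integrable_real_indicator) auto
  then have ind_int: "integrable lborel (\<lambda>x::'a. C * indicator (cball 0 (R + norm e)) x)"
    by (rule integrable_mult_right)
  have AE: "AE x in lborel. (\<lambda>k. q k x) \<longlonglongrightarrow> f' x e"
    "\<And>k. AE x in lborel. norm (q k x) \<le> C * indicator (cball 0 (R + norm e)) x"
    using lim q_bound by auto
  note dom = f'_meas q_meas ind_int AE
  show "integrable lborel (\<lambda>x. f' x e)" by (rule integrable_dominated_convergence[OF dom])
  have "(LBINT x. q k x) = 0" for k
    unfolding q_def using f_int shift_int lborel_integral_translation[OF meas]
    by (simp add: Bochner_Integration.integral_diff)
  then have "(\<lambda>k. 0) \<longlonglongrightarrow> (LBINT x. f' x e)"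
    using integral_dominated_convergence[OF dom] by simp
  then show "(LBINT x. f' x e) = 0" using LIMSEQ_unique tendsto_const by blast
qed

text \<open>Supplies the bound on the gradient of \<open>G\<close> that compactness cannot give,
  since this gradient is not known to be continuous.\<close>

lemma partial_deriv_bounded_by_lipschitz:
  fixes G :: "real ^ 'n \<Rightarrow> real"
  assumes diff: "G differentiable (at y)" and lip: "\<And>x y. \<bar>G x - G y\<bar> \<le> C * norm (x - y)"
  shows "\<bar>partial_deriv i G y\<bar> \<le> C"
proof -
  obtain G' where G': "(G has_derivative G') (at y)" using diff by (auto simp: differentiable_def)
  let ?e = "axis i (1::real)"
  have "((\<lambda>h. y + h *\<^sub>R ?e) has_derivative (\<lambda>h. h *\<^sub>R ?e)) (at 0)" by (auto intro!: derivative_eq_intros)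
  moreover have "(G has_derivative G') (at (y + 0 *\<^sub>R ?e))" using G' by simp
  ultimately have "((\<lambda>h. G (y + h *\<^sub>R ?e)) has_derivative (\<lambda>h. G' (h *\<^sub>R ?e))) (at 0)"
    by (rule has_derivative_compose)
  moreover have "(\<lambda>h. G' (h *\<^sub>R ?e)) = (*) (G' ?e)"
    using linear_scale[OF has_derivative_linear[OF G']] by (simp add: fun_eq_iff)
  ultimately have "((\<lambda>h. (G (y + h *\<^sub>R ?e) - G y) / h) \<longlongrightarrow> G' ?e) (at 0)"
    by (simp add: has_field_derivative_def[symmetric] has_field_derivative_iff)
  then have lim: "((\<lambda>h. \<bar>(G (y + h *\<^sub>R ?e) - G y) / h\<bar>) \<longlongrightarrow> \<bar>G' ?e\<bar>) (at 0)"
    by (rule tendsto_rabs)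
  have "\<bar>(G (y + h *\<^sub>R ?e) - G y) / h\<bar> \<le> C" if "h \<noteq> 0" for h
    using lip[of "y + h *\<^sub>R ?e" y] that by (simp add: field_simps)
  then have "eventually (\<lambda>h. \<bar>(G (y + h *\<^sub>R ?e) - G y) / h\<bar> \<le> C) (at 0)"
    by (auto simp: eventually_at_filter)
  then have "\<bar>G' ?e\<bar> \<le> C" by (rule tendsto_upperbound[OF lim]) simp
  then show ?thesis by (simp add: partial_deriv_eq[OF G'])
qed

lemma partial_deriv_eq_0_outside:
  fixes G :: "real ^ 'n \<Rightarrow> real"
  assumes "closed K" "\<And>y. y \<notin> K \<Longrightarrow> G y = 0" "y \<notin> K"
  shows "(G has_derivative (\<lambda>_. 0)) (at y)" "partial_deriv i G y = 0"
proof -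
  have "((\<lambda>_. 0) has_derivative (\<lambda>_. 0 :: real)) (at y)" by simp
  then show d: "(G has_derivative (\<lambda>_. 0)) (at y)"
    by (rule has_derivative_transform_within_open[OF _ open_Compl[OF assms(1)]]) (use assms in auto)
  show "partial_deriv i G y = 0" by (rule partial_deriv_eq[OF d])
qed

lemma integrable_on_compact_support:
  fixes f :: "'a::euclidean_space \<Rightarrow> real"
  assumes "compact K" "K \<subseteq> U" "continuous_on K f" "\<And>y. y \<notin> K \<Longrightarrow> f y = 0"
  shows "set_integrable lborel U f"
proof -
  have "(\<lambda>y. indicator K y *\<^sub>R f y) = (\<lambda>y. indicator U y *\<^sub>R f y)"
    using assms(2,4) by (auto simp: fun_eq_iff indicator_def)
  then show ?thesis
    using borel_integrable_compact[OF assms(1,3)] by (simp add: set_integrable_def)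
qed

text \<open>The weak form of \<open>div (G \<rho> v) = G div (\<rho> v) + \<rho> v \<cdot> \<nabla>G\<close>; note that \<open>\<nabla>G\<close> need not be continuous.\<close>

lemma integral_by_parts_along:
  fixes v :: "real ^ 'n \<Rightarrow> real ^ 'n" and G \<rho> :: "real ^ 'n \<Rightarrow> real"
  assumes U: "open U" and v: "\<forall>i. C1_on UNIV (\<lambda>x. v x $ i)" and \<rho>: "C1_on U \<rho>"
    and K: "compact K" "K \<subseteq> U"
    and G: "\<And>y. G differentiable (at y)" and lip: "\<And>x y. \<bar>G x - G y\<bar> \<le> C * norm (x - y)"
    and vanish: "\<And>y. y \<notin> K \<Longrightarrow> G y = 0"
  shows "(LBINT y:U. - deriv_along v G y * \<rho> y)
    = (LBINT y:U. G y * (deriv_along v \<rho> y + \<rho> y * divergence v y))"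
proof -
  \<comment> \<open>The i-th partial derivative of \<open>G * \<rho> * v\<^sup>i\<close>, extended
    by zero outside \<open>U\<close>; summed over i, it is the divergence whose integral
    vanishes.\<close>
  define a where "a i y = indicator U y * (G y * (\<rho> y * partial_deriv i (\<lambda>x. v x $ i) y
    + partial_deriv i \<rho> y * v y $ i) + partial_deriv i G y * (\<rho> y * v y $ i))" for i y
  have outside: "G y = 0" "partial_deriv i G y = 0" if "y \<notin> K" for i y
    using vanish partial_deriv_eq_0_outside(2)[OF compact_imp_closed[OF K(1)] vanish] that by auto
  have cont: "continuous_on K G" "continuous_on K \<rho>" "continuous_on K (\<lambda>y. v y $ i)"
    "continuous_on K (partial_deriv j \<rho>)" "continuous_on K (partial_deriv j (\<lambda>x. v x $ i))" for i j
  proof -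
    show "continuous_on K G"
      using G by (meson continuous_at_imp_continuous_on differentiable_imp_continuous_within)
    show "continuous_on K \<rho>" "continuous_on K (\<lambda>y. v y $ i)"
      using C1_on_continuous \<rho> v K(2) by (meson continuous_on_subset subset_UNIV)+
    show "continuous_on K (partial_deriv j \<rho>)" "continuous_on K (partial_deriv j (\<lambda>x. v x $ i))"
      using \<rho> v K(2) unfolding C1_on_iff by (meson continuous_on_subset subset_UNIV)+
  qed
  \<comment> \<open>The index is arbitrary: any pair of points at distance 1 shows that
    \<open>C\<close> is nonnegative.\<close>
  have C: "0 \<le> C" using order_trans[OF abs_ge_zero lip[of "axis undefined 1" 0]] by simp
  have "integrable lborel (a i) \<and> (LBINT y. a i y) = 0" for i
  proof -
    \<comment> \<open>The extension by zero is differentiable everywhere, because a point outside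
      \<open>U\<close> has a neighbourhood disjoint from the compact \<open>K\<close>.\<close>
    define f where "f y = (if y \<in> U then G y * (\<rho> y * v y $ i) else 0)" for y
    define f' where "f' y u = (if y \<in> U then
        G y * (\<rho> y * (\<Sum>j\<in>UNIV. u $ j * partial_deriv j (\<lambda>x. v x $ i) y)
          + (\<Sum>j\<in>UNIV. u $ j * partial_deriv j \<rho> y) * v y $ i)
        + (\<Sum>j\<in>UNIV. u $ j * partial_deriv j G y) * (\<rho> y * v y $ i) else 0)" for y u
    have a_eq: "f' y (axis i 1) = a i y" for y
      by (simp add: f'_def a_def axis_def if_distrib[of "\<lambda>x. x * _"] cong: if_cong)
    have der: "(f has_derivative f' y) (at y)" for y
    proof (cases "y \<in> U")
      case True
      have "((\<lambda>y. G y * (\<rho> y * v y $ i)) has_derivative f' y) (at y)"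
        using has_derivative_mult[OF has_derivative_partial_deriv[OF G[of y]]
          has_derivative_mult[OF has_derivative_partial_deriv[OF C1_on_differentiable[OF \<rho> True]]
            has_derivative_partial_deriv[OF C1_on_differentiable[OF v[rule_format, of i] UNIV_I]]]]
        by (rule has_derivative_eq_rhs) (use True in \<open>auto simp: f'_def fun_eq_iff\<close>)
      then show ?thesis
        by (rule has_derivative_transform_within_open[OF _ U True]) (simp add: f_def)
    next
      case False
      then have y: "y \<notin> K" using K by auto
      have "f' y = (\<lambda>_. 0)" using False by (simp add: f'_def fun_eq_iff)
      then show ?thesis
        using partial_deriv_eq_0_outside(1)[OF compact_imp_closed[OF K(1)] _ y, of f] by (simp add: f_def vanish)
    qed
    have "continuous_on K (\<lambda>y. G y * (\<rho> y * partial_deriv i (\<lambda>x. v x $ i) y + partial_deriv i \<rho> y * v y $ i))"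
      "continuous_on K (\<lambda>y. \<rho> y * v y $ i)"
      by (intro continuous_intros cont)+
    from this[THEN compact_continuous_image[OF _ K(1)], THEN compact_imp_bounded]
    obtain B1 B2 where B:
      "\<And>y. y \<in> K \<Longrightarrow> \<bar>G y * (\<rho> y * partial_deriv i (\<lambda>x. v x $ i) y + partial_deriv i \<rho> y * v y $ i)\<bar> \<le> B1"
      "\<And>y. y \<in> K \<Longrightarrow> \<bar>\<rho> y * v y $ i\<bar> \<le> B2"
      unfolding bounded_iff by (auto simp only: ball_simps real_norm_def)
    have bound: "\<bar>f' y (axis i 1)\<bar> \<le> \<bar>B1\<bar> + C * \<bar>B2\<bar>" for y
    proof (cases "y \<in> K")
      case True
      have "\<bar>f' y (axis i 1)\<bar> \<le> \<bar>G y * (\<rho> y * partial_deriv i (\<lambda>x. v x $ i) y + partial_deriv i \<rho> y * v y $ i)\<bar>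
          + \<bar>partial_deriv i G y\<bar> * \<bar>\<rho> y * v y $ i\<bar>"
        unfolding a_eq a_def using True K(2) by (auto simp: abs_mult[symmetric] simp del: abs_mult)
      also have "\<dots> \<le> \<bar>B1\<bar> + C * \<bar>B2\<bar>"
        using B[OF True] partial_deriv_bounded_by_lipschitz[OF G lip, of i y] C
        by (intro add_mono mult_mono) auto
      finally show ?thesis .
    next
      case False
      then show ?thesis using C by (simp add: a_eq a_def outside)
    qed
    have "f y = 0" if "y \<notin> K" for y using that by (simp add: f_def vanish)
    from integral_directional_derivative_eq_0[OF der bound compact_imp_bounded[OF K(1)] this]
    show ?thesis by (simp add: a_eq)
  qed
  then have a: "integrable lborel (a i)" "(LBINT y. a i y) = 0" for i by auto
  have "(\<Sum>i\<in>UNIV. a i y) = indicator U y *\<^sub>R (G y * (deriv_along v \<rho> y + \<rho> y * divergence v y))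
      - indicator U y *\<^sub>R (- deriv_along v G y * \<rho> y)" for y
    unfolding a_def sum_distrib_left[symmetric] deriv_along_def divergence_def
    by (simp add: sum.distrib sum_distrib_left sum_distrib_right algebra_simps)
  note sum_a = this
  have int1: "set_integrable lborel U (\<lambda>y. G y * (deriv_along v \<rho> y + \<rho> y * divergence v y))"
    using K vanish unfolding deriv_along_def divergence_def
    by (intro integrable_on_compact_support[of K] continuous_intros cont) auto
  have "integrable lborel (\<lambda>y. \<Sum>i\<in>UNIV. a i y)"
    using a(1) by (intro Bochner_Integration.integrable_sum)
  \<comment> \<open>The term with the gradient of \<open>G\<close> is not visibly integrable; it is
    the difference of two functions that are.\<close>
  from Bochner_Integration.integrable_diff[OF int1[unfolded set_integrable_def] this]
  have int2: "integrable lborel (\<lambda>y. indicator U y *\<^sub>R (- deriv_along v G y * \<rho> y))"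
    by (simp only: sum_a diff_diff_eq2 add_diff_cancel_left')
  have "0 = (LBINT y. \<Sum>i\<in>UNIV. a i y)" using a by simp
  also have "\<dots> = (LBINT y:U. G y * (deriv_along v \<rho> y + \<rho> y * divergence v y)) - (LBINT y:U. - deriv_along v G y * \<rho> y)"
    unfolding set_lebesgue_integral_def sum_a
    by (rule Bochner_Integration.integral_diff[OF int1[unfolded set_integrable_def] int2])
  finally show ?thesis by simp
qed

text \<open>\<open>\<Psi>\<close> abstracts the time-reversed flow. The displacement bound and the
  Lipschitz constant of \<open>G\<close> dominate the difference quotients, so \<open>\<Psi>\<close>
  has to be differentiable in time only at 0.\<close>

lemma density_transport_derivative:
  fixes v w :: "real ^ 'n \<Rightarrow> real ^ 'n" and G \<rho> :: "real ^ 'n \<Rightarrow> real" and \<Psi> :: "real \<Rightarrow> real ^ 'n \<Rightarrow> real ^ 'n"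
  assumes U: "open U" and \<rho>: "continuous_on U \<rho>" and K: "compact K" "K \<subseteq> U"
    and G: "\<And>y. G differentiable (at y)" and lip: "\<And>x y. \<bar>G x - G y\<bar> \<le> C * norm (x - y)"
    and vanish: "\<And>y. y \<notin> K \<Longrightarrow> G y = 0"
    and \<Psi>0: "\<And>y. \<Psi> 0 y = y" and disp: "\<And>h y. norm (\<Psi> h y - y) \<le> M * \<bar>h\<bar>"
    and \<Psi>_cont: "\<And>h. continuous_on UNIV (\<Psi> h)"
    and \<Psi>_der: "\<And>y. ((\<lambda>h. \<Psi> h y) has_vector_derivative - w y) (at 0)"
    and w: "\<And>y. y \<in> K \<Longrightarrow> w y = v y"
  shows "((\<lambda>h. LBINT y:U. G (\<Psi> h y) * \<rho> y) has_real_derivative (LBINT y:U. - deriv_along v G y * \<rho> y)) (at 0)"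
proof -
  have C: "0 \<le> C" using order_trans[OF abs_ge_zero lip[of "axis undefined 1" 0]] by simp
  have M: "0 \<le> M" using order_trans[OF norm_ge_zero disp[of 1]] by simp
  obtain e where e: "0 < e" "(\<Union>x\<in>K. cball x e) \<subseteq> U"
    using compact_subset_open_imp_cball_epsilon_subset[OF K(1) U K(2)] by blast
  \<comment> \<open>The closed \<open>e\<close>-neighbourhood of \<open>K\<close>, still compact in
    \<open>U\<close>. For \<open>\<bar>h\<bar> < d\<close> it contains all points where
    \<open>G (\<Psi> h y)\<close> is nonzero, and \<open>\<rho>\<close>, possibly unbounded on
    \<open>U\<close>, is bounded on it.\<close>
  define K' where "K' = (\<lambda>(x, y). x + y) ` (K \<times> cball 0 e)"
  have K'_compact: "compact K'"
    unfolding K'_def using K(1)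
    by (intro compact_continuous_image compact_Times) (auto simp: case_prod_unfold intro!: continuous_intros)
  have K'I: "y \<in> K'" if "x \<in> K" "norm (y - x) \<le> e" for x y
    unfolding K'_def using that by (intro image_eqI[of _ _ "(x, y - x)"]) auto
  have K'U: "K' \<subseteq> U"
  proof
    fix y assume "y \<in> K'"
    then obtain x z where "x \<in> K" "norm z \<le> e" "y = x + z" by (auto simp: K'_def)
    then have "y \<in> cball x e" by (simp add: dist_norm)
    with \<open>x \<in> K\<close> e(2) show "y \<in> U" by blast
  qed
  have KK': "K \<subseteq> K'" using K'I[of y y for y] e(1) by auto
  have "bounded (\<rho> ` K')"
    using \<rho> K'U K'_compact by (intro compact_imp_bounded compact_continuous_image) (auto intro: continuous_on_subset)
  then obtain B where B: "\<And>y. y \<in> K' \<Longrightarrow> \<bar>\<rho> y\<bar> \<le> B" unfolding bounded_iff by auto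
  define d where "d = e / (M + 1)"
  have d: "0 < d" "M * d \<le> e" using e(1) M by (auto simp: d_def field_simps)
  have off: "G (\<Psi> h y) = 0" if "\<bar>h\<bar> < d" "y \<notin> K'" for h y
  proof (rule vanish)
    have "norm (\<Psi> h y - y) \<le> M * d"
      using disp[of h y] that(1) M by (meson less_imp_le mult_left_mono order_trans)
    then show "\<Psi> h y \<notin> K" using K'I[of "\<Psi> h y" y] d(2) that(2) by (auto simp: norm_minus_commute)
  qed
  have G_cont: "continuous_on UNIV G"
    using G by (meson continuous_at_imp_continuous_on differentiable_imp_continuous_within)
  have int: "set_integrable lborel U (\<lambda>y. G (\<Psi> h y) * \<rho> y)" if "\<bar>h\<bar> < d" for h
  proof (rule integrable_on_compact_support[OF K'_compact K'U])
    show "continuous_on K' (\<lambda>y. G (\<Psi> h y) * \<rho> y)"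
      using continuous_on_subset[OF \<rho> K'U] continuous_on_compose2[OF G_cont \<Psi>_cont]
      by (intro continuous_on_mult) (auto intro: continuous_on_subset)
  qed (use off that in auto)
  have point: "((\<lambda>h. G (\<Psi> h y)) has_real_derivative - deriv_along v G y) (at 0)" for y
  proof -
    have "(G has_derivative (\<lambda>u. \<Sum>i\<in>UNIV. u $ i * partial_deriv i G y)) (at (\<Psi> 0 y))"
      using has_derivative_partial_deriv[OF G[of y]] by (simp add: \<Psi>0)
    from has_derivative_compose[OF \<Psi>_der[unfolded has_vector_derivative_def] this]
    have "((\<lambda>h. G (\<Psi> h y)) has_derivative (\<lambda>h. \<Sum>i\<in>UNIV. (h *\<^sub>R - w y) $ i * partial_deriv i G y)) (at 0)" .
    \<comment> \<open>The fields \<open>w\<close> and \<open>v\<close> are known to agree on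
      \<open>K\<close> only; off \<open>K\<close> the gradient of \<open>G\<close> is 0, so the
      difference is harmless.\<close>
    moreover have "(\<Sum>i\<in>UNIV. (h *\<^sub>R - w y) $ i * partial_deriv i G y) = - deriv_along v G y * h" for h
    proof (cases "y \<in> K")
      case True
      then show ?thesis by (simp add: w deriv_along_def sum_distrib_left sum_negf mult_ac flip: sum_distrib_left)
    next
      case False
      then show ?thesis
        using partial_deriv_eq_0_outside(2)[OF compact_imp_closed[OF K(1)] vanish False]
        by (simp add: deriv_along_def)
    qed
    ultimately show ?thesis by (simp only: has_field_derivative_def)
  qed
  define q where "q h y = indicator U y *\<^sub>R ((G (\<Psi> h y) - G y) / h * \<rho> y)" for h y
  have q_int: "integrable lborel (q h)" "(LBINT y. q h y) = ((LBINT y:U. G (\<Psi> h y) * \<rho> y) - (LBINT y:U. G (\<Psi> 0 y) * \<rho> y)) / h"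
    if h: "\<bar>h\<bar> < d" for h
  proof -
    have eq: "q h y = (indicator U y *\<^sub>R (G (\<Psi> h y) * \<rho> y) - indicator U y *\<^sub>R (G (\<Psi> 0 y) * \<rho> y)) / h" for y
      by (simp add: q_def \<Psi>0 diff_divide_distrib algebra_simps)
    have i: "integrable lborel (\<lambda>y. indicator U y *\<^sub>R (G (\<Psi> h y) * \<rho> y))"
      "integrable lborel (\<lambda>y. indicator U y *\<^sub>R (G (\<Psi> 0 y) * \<rho> y))"
      using int[OF h] int[of 0] d(1) by (auto simp: set_integrable_def)
    show "integrable lborel (q h)" unfolding eq using i by (intro integrable_divide_zero Bochner_Integration.integrable_diff)
    show "(LBINT y. q h y) = ((LBINT y:U. G (\<Psi> h y) * \<rho> y) - (LBINT y:U. G (\<Psi> 0 y) * \<rho> y)) / h"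
      unfolding eq set_lebesgue_integral_def using i by simp
  qed
  have q_bound: "\<bar>q h y\<bar> \<le> C * M * B * indicator K' y" if h: "\<bar>h\<bar> < d" "h \<noteq> 0" for h y
  proof (cases "y \<in> K'")
    case True
    have "\<bar>G (\<Psi> h y) - G y\<bar> \<le> C * (M * \<bar>h\<bar>)"
      by (rule order_trans[OF lip mult_left_mono[OF disp C]])
    then have "\<bar>(G (\<Psi> h y) - G y) / h\<bar> \<le> C * M" using h(2) by (simp add: field_simps)
    then have "\<bar>(G (\<Psi> h y) - G y) / h\<bar> * \<bar>\<rho> y\<bar> \<le> C * M * B"
      using B[OF True] C M by (intro mult_mono) auto
    then show ?thesis using True K'U by (auto simp: q_def abs_mult)
  next
    case False
    then have "G y = 0" using KK' vanish by blast
    then show ?thesis using False off[OF h(1) False] by (simp add: q_def)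
  qed
  \<comment> \<open>Dominated convergence speaks of sequences. Staying within
    \<open>ball 0 d\<close> makes the bound hold for every member of the sequence, not just
    eventually.\<close>
  have "((\<lambda>h. LBINT y. q h y) \<longlongrightarrow> (LBINT y:U. - deriv_along v G y * \<rho> y)) (at 0 within ball 0 d)"
    unfolding tendsto_at_iff_sequentially comp_def
  proof (intro allI impI)
    fix X :: "nat \<Rightarrow> real" assume X: "\<forall>i. X i \<in> ball 0 d - {0}" "X \<longlonglongrightarrow> 0"
    have X1: "\<bar>X i\<bar> < d" "X i \<noteq> 0" for i using X(1) by auto
    have X0: "filterlim X (at 0) sequentially" using X X1 by (auto simp: filterlim_at)
    have lim: "(\<lambda>i. q (X i) y) \<longlonglongrightarrow> indicator U y *\<^sub>R (- deriv_along v G y * \<rho> y)" for y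
    proof -
      have "((\<lambda>h. (G (\<Psi> h y) - G y) / h) \<longlongrightarrow> - deriv_along v G y) (at 0)"
        using point[of y] by (simp add: has_field_derivative_iff \<Psi>0)
      from filterlim_compose[OF this X0] show ?thesis unfolding q_def by (intro tendsto_intros)
    qed
    have meas: "q (X i) \<in> borel_measurable lborel" for i using q_int(1)[OF X1(1)] by auto
    show "(\<lambda>i. LBINT y. q (X i) y) \<longlonglongrightarrow> (LBINT y:U. - deriv_along v G y * \<rho> y)"
      unfolding set_lebesgue_integral_def
    proof (rule integral_dominated_convergence[where w = "\<lambda>y. C * M * B * indicator K' y"])
      show "(\<lambda>y. indicator U y *\<^sub>R (- deriv_along v G y * \<rho> y)) \<in> borel_measurable lborel"
        using lim meas by (rule borel_measurable_LIMSEQ_real)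
      show "integrable lborel (\<lambda>y. C * M * B * indicator K' y)"
        using emeasure_bounded_finite[OF compact_imp_bounded[OF K'_compact]] K'_compact
        by (intro integrable_mult_right integrable_real_indicator) (auto intro: borel_compact)
    qed (use lim meas q_bound X1 in auto)
  qed
  then have "((\<lambda>h. LBINT y. q h y) \<longlongrightarrow> (LBINT y:U. - deriv_along v G y * \<rho> y)) (at 0)"
    using d(1) by (simp add: at_within_open[of 0 "ball 0 d"])
  moreover have "eventually (\<lambda>h. (LBINT y. q h y) = ((LBINT y:U. G (\<Psi> h y) * \<rho> y) - (LBINT y:U. G (\<Psi> 0 y) * \<rho> y)) / h) (at 0)"
    using q_int(2) d(1) by (auto simp: eventually_at intro!: exI[of _ d])
  ultimately show ?thesis
    unfolding has_field_derivative_iff by (simp add: filterlim_cong)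
qed

section \<open>Bump functions\<close>

text \<open>For \<open>m = 0\<close> this is the classical smooth function with all derivatives 0 at
  the origin. Dividing by powers of \<open>t\<close> gives a family in which every derivative is a
  linear combination of members.\<close>

definition flat :: "nat \<Rightarrow> real \<Rightarrow> real" where
  "flat m t = (if 0 < t then exp (- (1 / t)) / t ^ m else 0)"

lemma flat_eq_0_iff: "flat m t = 0 \<longleftrightarrow> t \<le> 0"
  by (simp add: flat_def)

lemma flat_tendsto_0: "(flat m \<longlongrightarrow> 0) (at 0)"
proof (rule filterlim_split_at)
  show "(flat m \<longlongrightarrow> 0) (at_left 0)"
    by (rule tendsto_eventually) (auto simp: eventually_at_filter flat_def)
  have "((\<lambda>t. inverse t ^ m / exp (inverse t)) \<longlongrightarrow> 0) (at_right (0::real))"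
    by (rule filterlim_compose[OF tendsto_power_div_exp_0 filterlim_inverse_at_top_right])
  moreover have "eventually (\<lambda>t. inverse t ^ m / exp (inverse t) = flat m t) (at_right (0::real))"
    by (auto simp: eventually_at_filter flat_def exp_minus field_simps)
  ultimately show "(flat m \<longlongrightarrow> 0) (at_right 0)"
    by (rule Lim_transform_eventually)
qed

lemma flat_deriv: "(flat m has_real_derivative flat (m + 2) t - real m * flat (m + 1) t) (at t)"
proof (cases t "0::real" rule: linorder_cases)
  case less
  have "(flat m has_real_derivative 0) (at t)"
    by (rule has_field_derivative_transform_within_open[of "\<lambda>_. 0" _ _ "{..<0}"]) (use less in \<open>auto simp: flat_def\<close>)
  then show ?thesis using less by (simp add: flat_def)
next
  case equal
  \<comment> \<open>At the origin the difference quotient is again a member of the family, which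
    tends to 0.\<close>
  have "eventually (\<lambda>h. flat (m + 1) h = (flat m (0 + h) - flat m 0) / h) (at 0)"
    by (auto simp: eventually_at_filter flat_def)
  from Lim_transform_eventually[OF flat_tendsto_0 this]
  show ?thesis unfolding equal has_field_derivative_def
    by (simp add: DERIV_def flat_def flip: has_field_derivative_def)
next
  case greater
  have p: "real m * t ^ (m - 1) = real m * t ^ m / t" using greater by (cases m) auto
  have "((\<lambda>t. exp (- (1 / t)) / t ^ m) has_real_derivative flat (m + 2) t - real m * flat (m + 1) t) (at t)"
    using greater by (auto intro!: derivative_eq_intros simp: p[simplified] flat_def power2_eq_square field_simps)
  then show ?thesis
    by (rule has_field_derivative_transform_within_open[of _ _ _ "{0<..}"]) (use greater in \<open>auto simp: flat_def\<close>)
qed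

text \<open>An algebra of functions that contains bump functions and is closed under partial derivatives.\<close>

inductive_set flat_algebra :: "(real ^ 'n \<Rightarrow> real) set" where
  flat_const: "(\<lambda>_. c) \<in> flat_algebra"
| flat_coord: "(\<lambda>x. flat m (a + b * x $ i)) \<in> flat_algebra"
| flat_add: "f \<in> flat_algebra \<Longrightarrow> g \<in> flat_algebra \<Longrightarrow> (\<lambda>x. f x + g x) \<in> flat_algebra"
| flat_mult: "f \<in> flat_algebra \<Longrightarrow> g \<in> flat_algebra \<Longrightarrow> (\<lambda>x. f x * g x) \<in> flat_algebra"

lemma flat_algebra_derivative:
  assumes "f \<in> flat_algebra"
  shows "\<exists>D. (\<forall>x. (f has_derivative (\<lambda>u. \<Sum>i\<in>UNIV. u $ i * D i x)) (at x)) \<and> (\<forall>i. D i \<in> flat_algebra)"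
  using assms
proof induction
  case (flat_const c)
  show ?case by (rule exI[of _ "\<lambda>_ _. 0"]) (auto intro: flat_algebra.flat_const)
next
  case (flat_coord m a b i)
  \<comment> \<open>The difference in \<open>flat_deriv\<close> is written with the constant
    \<open>- real m\<close>, since the algebra is generated by sums and products.\<close>
  define E where "E x = b * (flat (m + 2) (a + b * x $ i) + (- real m) * flat (m + 1) (a + b * x $ i))"
    for x :: "real ^ 'a"
  have E: "E \<in> flat_algebra"
    unfolding E_def by (intro flat_algebra.intros)
  have "((\<lambda>x. flat m (a + b * x $ i)) has_derivative (\<lambda>u. u $ i * E x)) (at x)" for x :: "real ^ 'a"
  proof -
    have "((\<lambda>x. a + b * x $ i) has_derivative (\<lambda>u. b * u $ i)) (at x)"
      by (auto intro!: derivative_eq_intros bounded_linear.has_derivative[OF bounded_linear_vec_nth])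
    from has_derivative_compose[OF this flat_deriv[of m "a + b * x $ i", unfolded has_field_derivative_def]]
    show ?thesis
      by (rule has_derivative_eq_rhs) (simp add: E_def fun_eq_iff algebra_simps)
  qed
  moreover have "(\<Sum>j\<in>UNIV. u $ j * (if j = i then E x else 0)) = u $ i * E x" for u x
    by (simp add: if_distrib[of "\<lambda>z. _ * z"] cong: if_cong)
  moreover have "(\<lambda>x. if j = i then E x else 0) \<in> flat_algebra" for j
    using E flat_algebra.flat_const[of 0] by (cases "j = i") auto
  ultimately show ?case
    by (intro exI[of _ "\<lambda>j x. if j = i then E x else 0"]) simp
next
  case (flat_add f g)
  then obtain D D' where D: "\<And>x. (f has_derivative (\<lambda>u. \<Sum>i\<in>UNIV. u $ i * D i x)) (at x)" "\<And>i. D i \<in> flat_algebra"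
    and D': "\<And>x. (g has_derivative (\<lambda>u. \<Sum>i\<in>UNIV. u $ i * D' i x)) (at x)" "\<And>i. D' i \<in> flat_algebra"
    by blast
  show ?case
    using has_derivative_add[OF D(1) D'(1)] D(2) D'(2)
    by (intro exI[of _ "\<lambda>i x. D i x + D' i x"])
      (auto simp: sum.distrib[symmetric] distrib_left intro: flat_algebra.flat_add)
next
  case (flat_mult f g)
  then obtain D D' where D: "\<And>x. (f has_derivative (\<lambda>u. \<Sum>i\<in>UNIV. u $ i * D i x)) (at x)" "\<And>i. D i \<in> flat_algebra"
    and D': "\<And>x. (g has_derivative (\<lambda>u. \<Sum>i\<in>UNIV. u $ i * D' i x)) (at x)" "\<And>i. D' i \<in> flat_algebra"
    by blast
  have "((\<lambda>x. f x * g x) has_derivative (\<lambda>u. \<Sum>i\<in>UNIV. u $ i * (f x * D' i x + D i x * g x))) (at x)" for x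
    by (rule has_derivative_eq_rhs[OF has_derivative_mult[OF D(1) D'(1)]])
      (simp add: fun_eq_iff sum_distrib_left sum_distrib_right sum.distrib[symmetric] algebra_simps)
  moreover have "(\<lambda>x. f x * D' i x + D i x * g x) \<in> flat_algebra" for i
    by (intro flat_algebra.flat_add flat_algebra.flat_mult flat_mult.hyps D(2) D'(2))
  ultimately show ?case
    by (intro exI[of _ "\<lambda>i x. f x * D' i x + D i x * g x"]) blast
qed

lemma flat_algebra_Ck: "f \<in> flat_algebra \<Longrightarrow> Ck_on k UNIV f"
proof (induction k arbitrary: f)
  case (0 f)
  then have "isCont f x" for x
    using flat_algebra_derivative has_derivative_continuous by blast
  then show ?case by (simp add: continuous_at_imp_continuous_on)
next
  case (Suc k f)
  obtain D where D: "\<And>x. (f has_derivative (\<lambda>u. \<Sum>i\<in>UNIV. u $ i * D i x)) (at x)" "\<And>i. D i \<in> flat_algebra"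
    using flat_algebra_derivative[OF Suc.prems] by blast
  have "partial_deriv i f = D i" for i
    using partial_deriv_eq[OF D(1)]
    by (simp add: fun_eq_iff axis_def if_distrib[of "\<lambda>x. x * _"] cong: if_cong)
  then show ?case
    using D Suc.IH by (auto simp: differentiable_def)
qed

lemma flat_algebra_prod:
  "finite I \<Longrightarrow> (\<And>i. i \<in> I \<Longrightarrow> f i \<in> flat_algebra) \<Longrightarrow> (\<lambda>x. \<Prod>i\<in>I. f i x) \<in> flat_algebra"
proof (induction I rule: finite_induct)
  case empty
  show ?case using flat_algebra.flat_const[of 1] by simp
next
  case (insert j I)
  then have "(\<lambda>x. f j x * (\<Prod>i\<in>I. f i x)) \<in> flat_algebra"
    by (intro flat_algebra.flat_mult insert.IH insert.prems) simp_all
  then show ?case using insert.hyps by simp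
qed

lemma bump_function_exists:
  fixes a :: "real ^ 'n"
  assumes "open U" "a \<in> U"
  obtains \<Delta> where "test_function U \<Delta>" "\<And>x. 0 \<le> \<Delta> x" "0 < \<Delta> a"
proof -
  obtain e where e: "0 < e" "cball a e \<subseteq> U" using assms by (meson open_contains_cball)
  \<comment> \<open>The Euclidean norm is at most the sum of the absolute coordinates, so a cube of
    this half-width fits into the ball of radius \<open>e\<close>.\<close>
  define r where "r = e / CARD('n)"
  have r: "0 < r" using e(1) by (simp add: r_def)
  \<comment> \<open>Each coordinate has one factor for either side, so the product is positive
    exactly on the open cube about \<open>a\<close>. The coefficients 1 and -1 are spelled out to
    match \<open>flat_coord\<close>.\<close>
  define \<Delta> where "\<Delta> x = (\<Prod>i\<in>UNIV. flat 0 ((r - a $ i) + 1 * x $ i) * flat 0 ((r + a $ i) + (- 1) * x $ i))" for x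
  have smooth: "smooth_on UNIV \<Delta>"
    unfolding smooth_on_def \<Delta>_def
    by (intro allI flat_algebra_Ck flat_algebra_prod flat_algebra.intros) auto
  have "x \<in> cball a e" if "\<Delta> x \<noteq> 0" for x
  proof -
    have "flat 0 ((r - a $ i) + 1 * x $ i) * flat 0 ((r + a $ i) + (- 1) * x $ i) \<noteq> 0" for i
      using that unfolding \<Delta>_def by (simp add: prod_zero_iff)
    then have nz: "flat 0 ((r - a $ i) + 1 * x $ i) \<noteq> 0" "flat 0 ((r + a $ i) + (- 1) * x $ i) \<noteq> 0" for i
      by simp_all
    have "\<bar>(x - a) $ i\<bar> \<le> r" for i
      using nz[of i] unfolding flat_eq_0_iff vector_minus_component by linarith
    then have "(\<Sum>i\<in>UNIV. \<bar>(x - a) $ i\<bar>) \<le> real CARD('n) * r"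
      by (intro sum_bounded_above) auto
    then have "norm (x - a) \<le> e"
      using norm_le_l1_cart[of "x - a"] by (simp add: r_def)
    then show ?thesis by (simp add: dist_norm norm_minus_commute)
  qed
  then have "supp \<Delta> \<subseteq> cball a e" unfolding supp_def by (intro closure_minimal) auto
  moreover have "closed (supp \<Delta>)" by (simp add: supp_def)
  ultimately have "compact (supp \<Delta>)" "supp \<Delta> \<subseteq> U"
    using e(2) compact_Int_closed[OF compact_cball, of "supp \<Delta>" a e] by (auto simp: Int_absorb1)
  then have "test_function U \<Delta>" using smooth by (simp add: test_function_def)
  moreover have "0 \<le> \<Delta> x" for x unfolding \<Delta>_def by (intro prod_nonneg) (auto simp: flat_def)
  moreover have "0 < \<Delta> a" unfolding \<Delta>_def using r by (intro prod_pos) (auto simp: flat_def)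
  ultimately show ?thesis by (rule that)
qed

section \<open>The fundamental lemma of the calculus of variations\<close>

lemma vanishes_outside_supp:
  assumes "x \<notin> supp f"
  shows "f x = 0"
proof (rule ccontr)
  assume "f x \<noteq> 0"
  then have "x \<in> {x. f x \<noteq> 0}" by (rule CollectI)
  from subsetD[OF closure_subset this] assms show False unfolding supp_def by (rule notE[rotated])
qed

lemma test_function_continuous:
  assumes "test_function U \<Delta>"
  shows "continuous_on S \<Delta>"
proof -
  have "Ck_on 0 UNIV \<Delta>" using assms unfolding test_function_def smooth_on_def by blast
  then show ?thesis unfolding Ck_on.simps(1) by (rule continuous_on_subset) simp
qed

text \<open>If \<open>g\<close> were positive at \<open>a\<close>, a bump supported where
  \<open>g\<close> is positive would make the integrand nonnegative with integral 0, hence zero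
  almost everywhere. But it is positive on the nonempty open set where the bump is positive, which
  is not a null set.\<close>

lemma nonpos_of_test_integrals:
  fixes g :: "real ^ 'n \<Rightarrow> real"
  assumes U: "open U" and g: "continuous_on U g"
    and zero: "\<And>\<Delta>. test_function U \<Delta> \<Longrightarrow> (LBINT x:U. \<Delta> x * g x) = 0"
    and a: "a \<in> U"
  shows "g a \<le> 0"
proof (rule ccontr)
  assume "\<not> g a \<le> 0"
  then have ga: "0 < g a" by simp
  define V where "V = {x\<in>U. 0 < g x}"
  have "open V"
  proof -
    have "V = U \<inter> g -` {0<..}" by (auto simp: V_def)
    then show ?thesis using continuous_open_preimage[OF g U, of "{0<..}"] by simp
  qed
  moreover have "a \<in> V" using a ga by (simp add: V_def)
  ultimately obtain \<Delta> where \<Delta>: "test_function V \<Delta>" "\<And>x. 0 \<le> \<Delta> x" "0 < \<Delta> a"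
    by (rule bump_function_exists) auto
  have V: "V \<subseteq> U" by (auto simp: V_def)
  have supp: "compact (supp \<Delta>)" "supp \<Delta> \<subseteq> V" using \<Delta>(1) by (auto simp: test_function_def)
  have test: "test_function U \<Delta>" using \<Delta>(1) V by (auto simp: test_function_def)
  have int: "integrable lborel (\<lambda>x. indicator U x *\<^sub>R (\<Delta> x * g x))"
    unfolding set_integrable_def[symmetric]
  proof (rule integrable_on_compact_support)
    show "continuous_on (supp \<Delta>) (\<lambda>x. \<Delta> x * g x)"
      using supp V by (intro continuous_on_mult test_function_continuous[OF test]) (auto intro: continuous_on_subset[OF g])
  qed (use supp V in \<open>auto simp: vanishes_outside_supp\<close>)
  have nonneg: "0 \<le> indicator U x *\<^sub>R (\<Delta> x * g x)" for x
  proof (cases "x \<in> supp \<Delta>")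
    case True
    then have "0 < g x" using supp by (auto simp: V_def)
    then show ?thesis using \<Delta>(2)[of x] by simp
  qed (simp add: vanishes_outside_supp)
  have "AE x in lborel. indicator U x *\<^sub>R (\<Delta> x * g x) = 0"
    using integral_nonneg_eq_0_iff_AE[OF int] nonneg zero[OF test] by (simp add: set_lebesgue_integral_def)
  then obtain N where N: "{x. indicator U x *\<^sub>R (\<Delta> x * g x) \<noteq> 0} \<subseteq> N" "N \<in> null_sets lborel"
    by (rule AE_E3) auto
  define W where "W = {x. 0 < \<Delta> x}"
  have "open W"
    unfolding W_def using test_function_continuous[OF test, of UNIV]
    by (intro open_Collect_less) auto
  moreover have "W \<subseteq> N"
  proof
    fix x assume "x \<in> W"
    then have "x \<in> supp \<Delta>" using vanishes_outside_supp[of x \<Delta>] by (auto simp: W_def)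
    then have "x \<in> U" "0 < g x" using supp V by (auto simp: V_def)
    then show "x \<in> N" using N(1) \<open>x \<in> W\<close> by (auto simp: W_def)
  qed
  moreover have "negligible N"
    using N(2) by (simp add: negligible_iff_null_sets null_sets_completionI)
  ultimately have "W = {}" using open_not_negligible negligible_subset by blast
  then show False using \<Delta>(3) by (auto simp: W_def)
qed

lemma fundamental_lemma_calculus_of_variations:
  fixes g :: "real ^ 'n \<Rightarrow> real"
  assumes "open U" "continuous_on U g"
    and zero: "\<And>\<Delta>. test_function U \<Delta> \<Longrightarrow> (LBINT x:U. \<Delta> x * g x) = 0"
    and "a \<in> U"
  shows "g a = 0"
proof -
  have "(LBINT x:U. \<Delta> x * - g x) = 0" if "test_function U \<Delta>" for \<Delta>
    using zero[OF that] by (simp add: set_lebesgue_integral_def)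
  from nonpos_of_test_integrals[OF assms(1) continuous_on_minus[OF assms(2)] this assms(4)]
    nonpos_of_test_integrals[OF assms]
  show ?thesis by simp
qed

section \<open>Preserved densities\<close>

lemma test_function_differentiable: "test_function U \<Delta> \<Longrightarrow> \<Delta> differentiable (at x)"
  unfolding test_function_def smooth_on_def using C1_on_differentiable by blast

text \<open>The partial derivatives are bounded on the compact support by continuity and vanish off
  it, so the mean value inequality applies on the whole space.\<close>

lemma test_function_lipschitz:
  fixes \<Delta> :: "real ^ 'n \<Rightarrow> real"
  assumes "test_function U \<Delta>"
  obtains C where "0 \<le> C" "\<And>x y. \<bar>\<Delta> x - \<Delta> y\<bar> \<le> C * norm (x - y)"
proof -
  have C1: "C1_on UNIV \<Delta>" and K: "compact (supp \<Delta>)"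
    using assms unfolding test_function_def smooth_on_def by blast+
  have "\<exists>B. \<forall>x\<in>supp \<Delta>. \<bar>partial_deriv i \<Delta> x\<bar> \<le> B" for i
  proof -
    have "continuous_on (supp \<Delta>) (partial_deriv i \<Delta>)"
      using C1 unfolding C1_on_iff by (meson continuous_on_subset subset_UNIV)
    then have "bounded (partial_deriv i \<Delta> ` supp \<Delta>)"
      using K by (intro compact_imp_bounded compact_continuous_image)
    then show ?thesis unfolding bounded_iff by auto
  qed
  then obtain B where B: "\<And>i x. x \<in> supp \<Delta> \<Longrightarrow> \<bar>partial_deriv i \<Delta> x\<bar> \<le> B i" by metis
  have pd: "\<bar>partial_deriv i \<Delta> x\<bar> \<le> \<bar>B i\<bar>" for i x
  proof (cases "x \<in> supp \<Delta>")
    case False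
    have "partial_deriv i \<Delta> x = 0"
      by (rule partial_deriv_eq_0_outside(2)[OF compact_imp_closed[OF K] _ False]) (rule vanishes_outside_supp)
    then show ?thesis by simp
  qed (use B[of x i] in auto)
  have "norm (\<Delta> x - \<Delta> y) \<le> (\<Sum>i\<in>UNIV. \<bar>B i\<bar>) * norm (x - y)" for x y
  proof (rule differentiable_bound[where S = UNIV])
    fix x
    show "(\<Delta> has_derivative (\<lambda>u. \<Sum>i\<in>UNIV. u $ i * partial_deriv i \<Delta> x)) (at x)"
      using has_derivative_partial_deriv[OF test_function_differentiable[OF assms]] .
    have "norm (\<Sum>i\<in>UNIV. u $ i * partial_deriv i \<Delta> x) \<le> (\<Sum>i\<in>UNIV. \<bar>B i\<bar>) * norm u" for u
      unfolding sum_distrib_right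
      by (intro sum_norm_le) (auto simp: abs_mult mult.commute[of "\<bar>B _\<bar>"] intro!: mult_mono component_le_norm_cart pd)
    then show "onorm (\<lambda>u. \<Sum>i\<in>UNIV. u $ i * partial_deriv i \<Delta> x) \<le> (\<Sum>i\<in>UNIV. \<bar>B i\<bar>)"
      by (rule onorm_le)
  qed auto
  then show ?thesis by (intro that[of "\<Sum>i\<in>UNIV. \<bar>B i\<bar>"]) (auto intro: sum_nonneg)
qed

text \<open>By the group law, transporting for time t + h means composing \<open>G\<close>, the
  function transported for time t, with \<open>\<Phi> (- h)\<close>. Thus every admissible time is
  treated like time 0, at the price that \<open>G\<close> is less regular than a test
  function.\<close>

lemma (in C1_field) transport_derivative:
  assumes v: "\<forall>i. C1_on UNIV (\<lambda>x. v x $ i)" and U: "open U" and \<rho>: "C1_on U \<rho>"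
    and test: "test_function U \<Delta>" and t: "t \<in> admissible_times v U \<Delta>"
  shows "((\<lambda>s. density_measure U \<rho> (transport v \<Delta> s)) has_real_derivative
    (LBINT y:U. transport v \<Delta> t y * (deriv_along v \<rho> y + \<rho> y * divergence v y))) (at t)"
proof (rule transport_near_time[of \<Delta> t])
  show supp: "compact (supp \<Delta>)" using test by (simp add: test_function_def)
  have adm: "flow_defined v t x" "flow v t x \<in> U" if "x \<in> supp \<Delta>" for x
    using t that by (auto simp: admissible_times_def)
  then show "flow_defined v t x" if "x \<in> supp \<Delta>" for x using that by blast
  fix w L M R \<delta>
  assume w: "global_flow w L M" and eq: "\<And>z. norm z \<le> R + 1 \<Longrightarrow> w z = v z" and \<delta>: "0 < \<delta>"
    and traj: "\<And>x s. x \<in> supp \<Delta> \<Longrightarrow> s \<in> closed_segment 0 t \<Longrightarrow> norm (global_flow.\<Phi> w s x) \<le> R"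
    and flow: "\<And>x. x \<in> supp \<Delta> \<Longrightarrow> flow v t x = global_flow.\<Phi> w t x"
    and transport: "\<And>s. \<bar>s - t\<bar> \<le> \<delta> \<Longrightarrow> transport v \<Delta> s = (\<lambda>y. \<Delta> (global_flow.\<Phi> w (- s) y))"
  interpret global_flow w L M by (rule w)
  define G where "G y = \<Delta> (\<Phi> (- t) y)" for y
  define K where "K = \<Phi> t ` supp \<Delta>"
  have K: "compact K" "K \<subseteq> U"
    unfolding K_def using adm(2) flow by (auto intro!: compact_continuous_image continuous_on_\<Phi> supp)
  have K_iff: "y \<in> K \<longleftrightarrow> \<Phi> (- t) y \<in> supp \<Delta>" for y
  proof
    assume "\<Phi> (- t) y \<in> supp \<Delta>"
    then have "\<Phi> t (\<Phi> (- t) y) \<in> K" unfolding K_def by (rule imageI)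
    then show "y \<in> K" by simp
  qed (auto simp: K_def)
  have vanish: "G y = 0" if "y \<notin> K" for y
    using that unfolding G_def K_iff by (rule vanishes_outside_supp)
  obtain C where C: "0 \<le> C" "\<And>x y. \<bar>\<Delta> x - \<Delta> y\<bar> \<le> C * norm (x - y)"
    using test_function_lipschitz[OF test] by blast
  have lip: "\<bar>G x - G y\<bar> \<le> (C * exp (L * \<bar>t\<bar>)) * norm (x - y)" for x y
    using order_trans[OF C(2) mult_left_mono[OF \<Phi>_lipschitz C(1)], of "- t" x y]
    by (simp add: G_def mult.assoc)
  have G: "G differentiable (at y)" for y
  \<comment> \<open>\<open>\<Phi> (- t)\<close> is known to be differentiable only where the
    trajectory stays in the ball; on the open complement of \<open>K\<close> it suffices that
    \<open>G\<close> vanishes.\<close>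
  proof (cases "y \<in> K")
    case True
    then obtain x where x: "x \<in> supp \<Delta>" "y = \<Phi> t x" by (auto simp: K_def)
    \<comment> \<open>Backward in time, the trajectory of \<open>y\<close> retraces that of
      \<open>x\<close>, so the bound for the latter carries over.\<close>
    have bound: "norm (\<Phi> s y) \<le> R" if "s \<in> closed_segment 0 (- t)" for s
    proof -
      have "s + t \<in> closed_segment 0 t"
        using that by (auto simp: closed_segment_eq_real_ivl split: if_splits)
      from traj[OF x(1) this] show ?thesis by (simp add: x(2) \<Phi>_add)
    qed
    have "\<Phi> (- t) differentiable (at y)"
      by (rule \<Phi>_differentiable[OF v_deriv DV_cont eq bound])
    from differentiable_chain_at[OF this test_function_differentiable[OF test]]
    show ?thesis by (simp add: o_def G_def[abs_def])
  next
    case False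
    have "(G has_derivative (\<lambda>_. 0)) (at y)"
      by (rule partial_deriv_eq_0_outside(1)[OF compact_imp_closed[OF K(1)] _ False]) (rule vanish)
    then show ?thesis by (auto simp: differentiable_def)
  qed
  have "((\<lambda>h. LBINT y:U. G (\<Phi> (- h) y) * \<rho> y) has_real_derivative (LBINT y:U. - deriv_along v G y * \<rho> y)) (at 0)"
  proof (rule density_transport_derivative[OF U C1_on_continuous[OF \<rho>] K G lip])
    show "norm (\<Phi> (- h) y - y) \<le> M * \<bar>h\<bar>" for h y
      using \<Phi>_displacement[of "- h" y 0] by simp
    show "((\<lambda>h. \<Phi> (- h) y) has_vector_derivative - w y) (at 0)" for y
      using has_vector_derivative_reflect[of "\<lambda>h. \<Phi> h y" "w y" 0 UNIV] \<Phi>_deriv[of y 0] by simp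
    show "w y = v y" if "y \<in> K" for y
    proof -
      from that obtain x where "x \<in> supp \<Delta>" "y = \<Phi> t x" unfolding K_def by blast
      then have "norm y \<le> R" using traj[of x t] by simp
      then show ?thesis by (intro eq) simp
    qed
  qed (simp_all add: vanish continuous_on_\<Phi>)
  moreover have "(LBINT y:U. - deriv_along v G y * \<rho> y) = (LBINT y:U. G y * (deriv_along v \<rho> y + \<rho> y * divergence v y))"
    by (rule integral_by_parts_along[OF U v \<rho> K G lip]) (rule vanish)
  moreover have "G = transport v \<Delta> t" using transport[of t] \<delta> by (simp add: G_def fun_eq_iff)
  ultimately have der: "((\<lambda>h. LBINT y:U. transport v \<Delta> t (\<Phi> (- h) y) * \<rho> y) has_real_derivative
    (LBINT y:U. transport v \<Delta> t y * (deriv_along v \<rho> y + \<rho> y * divergence v y))) (at 0)"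
    by (simp only:)
  have "((\<lambda>h. density_measure U \<rho> (transport v \<Delta> (h + t))) has_real_derivative
    (LBINT y:U. transport v \<Delta> t y * (deriv_along v \<rho> y + \<rho> y * divergence v y))) (at 0)"
  proof (rule has_field_derivative_transform_within[OF der \<delta>])
    fix h :: real assume "dist h 0 < \<delta>"
    then have "transport v \<Delta> (h + t) = (\<lambda>y. \<Delta> (\<Phi> (- (h + t)) y))" by (intro transport) auto
    moreover have "\<Phi> (- (h + t)) y = \<Phi> (- t) (\<Phi> (- h) y)" for y
      by (simp add: add.commute flip: \<Phi>_add)
    ultimately show "(LBINT y:U. transport v \<Delta> t (\<Phi> (- h) y) * \<rho> y) = density_measure U \<rho> (transport v \<Delta> (h + t))"
      using transport[of t] \<delta> by (simp add: density_measure_def)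
  qed simp
  then show ?thesis using DERIV_shift[of "\<lambda>s. density_measure U \<rho> (transport v \<Delta> s)" _ 0 t] by simp
qed

lemma (in C1_field) flow_at_0: "flow_defined v 0 x" "flow v 0 x = x"
proof -
  \<comment> \<open>\<open>closed_segment 0 0\<close> is a single point, so the equation is a
    condition at time 0 only and a straight line serves as solution.\<close>
  have "((\<lambda>s. x + s *\<^sub>R v x) has_vector_derivative v x) (at 0 within {0})"
    by (auto intro!: derivative_eq_intros)
  then have "solution_upto v x 0 (\<lambda>s. x + s *\<^sub>R v x)" by (simp add: solution_upto_def)
  then show "flow_defined v 0 x" "flow v 0 x = x" using flow_eq by (auto simp: flow_defined_def)
qed

lemma (in C1_field) transport_0: "transport v \<Delta> 0 = \<Delta>"
proof
  fix y
  have id: "flow v 0 = (\<lambda>x. x)" using flow_at_0(2) by blast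
  have "inv_into (supp \<Delta>) (\<lambda>x. x) y = y" if "y \<in> supp \<Delta>"
    using inv_into_f_f[of "\<lambda>x. x" "supp \<Delta>" y] that by simp
  then show "transport v \<Delta> 0 y = \<Delta> y"
    unfolding transport_def id using vanishes_outside_supp[of y \<Delta>] by auto
qed

lemma (in C1_field) preserved_by_flow_iff:
  assumes v: "\<forall>i. C1_on UNIV (\<lambda>x. v x $ i)" and U: "open U" and \<rho>: "C1_on U \<rho>"
  shows "preserved_by_flow v U \<rho> \<longleftrightarrow> (\<forall>x\<in>U. deriv_along v \<rho> x + \<rho> x * divergence v x = 0)"
proof
  assume pres: "preserved_by_flow v U \<rho>"
  show "\<forall>x\<in>U. deriv_along v \<rho> x + \<rho> x * divergence v x = 0"
  proof
    fix x assume "x \<in> U"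
    show "deriv_along v \<rho> x + \<rho> x * divergence v x = 0"
    proof (rule fundamental_lemma_calculus_of_variations[OF U _ _ \<open>x \<in> U\<close>])
      have cont: "continuous_on U (\<lambda>y. v y $ i)" "continuous_on U (partial_deriv j (\<lambda>x. v x $ i))" for i j
        using v C1_on_continuous unfolding C1_on_iff by (meson continuous_on_subset subset_UNIV)+
      have cont': "continuous_on U (partial_deriv i \<rho>)" for i using \<rho> unfolding C1_on_iff by blast
      show "continuous_on U (\<lambda>x. deriv_along v \<rho> x + \<rho> x * divergence v x)"
        unfolding deriv_along_def divergence_def
        by (intro continuous_intros cont cont' C1_on_continuous[OF \<rho>])
    next
      fix \<Delta> assume test: "test_function U \<Delta>"
      then have adm: "0 \<in> admissible_times v U \<Delta>"
        using flow_at_0 by (auto simp: admissible_times_def test_function_def)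
      show "(LBINT x:U. \<Delta> x * (deriv_along v \<rho> x + \<rho> x * divergence v x)) = 0"
        using DERIV_unique transport_derivative[OF v U \<rho> test adm] pres test adm
        unfolding preserved_by_flow_def transport_0 by blast
    qed
  qed
next
  assume pde: "\<forall>x\<in>U. deriv_along v \<rho> x + \<rho> x * divergence v x = 0"
  \<comment> \<open>Stated for arbitrary \<open>\<Delta>\<close>, because it is applied to
    transported functions, which in general are not test functions.\<close>
  have "(LBINT y:U. \<Delta> y * (deriv_along v \<rho> y + \<rho> y * divergence v y)) = 0" for \<Delta>
  proof -
    have "indicator U y *\<^sub>R (\<Delta> y * (deriv_along v \<rho> y + \<rho> y * divergence v y)) = 0" for y
      using pde by (cases "y \<in> U") auto
    then show ?thesis by (simp only: set_lebesgue_integral_def integral_zero)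
  qed
  then show "preserved_by_flow v U \<rho>"
    unfolding preserved_by_flow_def using transport_derivative[OF v U \<rho>] by metis
qed

section \<open>Ratios of preserved densities\<close>

lemma ratio_partial_deriv:
  fixes \<rho>1 \<rho>2 :: "real ^ 'n \<Rightarrow> real"
  assumes "\<rho>1 differentiable (at x)" "\<rho>2 differentiable (at x)" "\<rho>2 x \<noteq> 0"
  shows "(\<lambda>x. \<rho>1 x / \<rho>2 x) differentiable (at x)"
    and "partial_deriv i (\<lambda>x. \<rho>1 x / \<rho>2 x) x
      = (partial_deriv i \<rho>1 x * \<rho>2 x - \<rho>1 x * partial_deriv i \<rho>2 x) / (\<rho>2 x * \<rho>2 x)"
proof -
  obtain D1 D2 where D: "(\<rho>1 has_derivative D1) (at x)" "(\<rho>2 has_derivative D2) (at x)"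
    using assms(1,2) by (auto simp: differentiable_def)
  note d = has_derivative_divide'[OF D assms(3)]
  then show "(\<lambda>x. \<rho>1 x / \<rho>2 x) differentiable (at x)" by (auto simp: differentiable_def)
  show "partial_deriv i (\<lambda>x. \<rho>1 x / \<rho>2 x) x
      = (partial_deriv i \<rho>1 x * \<rho>2 x - \<rho>1 x * partial_deriv i \<rho>2 x) / (\<rho>2 x * \<rho>2 x)"
    by (simp add: partial_deriv_eq[OF d] partial_deriv_eq[OF D(1)] partial_deriv_eq[OF D(2)])
qed

text \<open>Both densities satisfy the same linear equation, so along the flow they have the same
  logarithmic rate, minus the divergence. In the numerator of the quotient rule the two
  contributions \<open>\<rho>1 * \<rho>2 * divergence v\<close> cancel.\<close>

lemma ratio_of_solutions_is_integral:
  fixes v :: "real ^ 'n \<Rightarrow> real ^ 'n"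
  assumes U: "open U" and \<rho>: "C1_on U \<rho>1" "C1_on U \<rho>2"
    and pde: "\<forall>x\<in>U. deriv_along v \<rho>1 x + \<rho>1 x * divergence v x = 0"
      "\<forall>x\<in>U. deriv_along v \<rho>2 x + \<rho>2 x * divergence v x = 0"
  shows "integral_of_flow v {x\<in>U. \<rho>2 x \<noteq> 0} (\<lambda>x. \<rho>1 x / \<rho>2 x)"
proof -
  let ?W = "{x\<in>U. \<rho>2 x \<noteq> 0}"
  have "?W = U \<inter> \<rho>2 -` (- {0})" by auto
  then have W: "open ?W"
    using continuous_open_preimage[OF C1_on_continuous[OF \<rho>(2)] U, of "- {0}"] by (simp add: open_Compl)
  have diff: "\<rho>1 differentiable (at x)" "\<rho>2 differentiable (at x)" "\<rho>2 x \<noteq> 0" if "x \<in> ?W" for x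
    using that C1_on_differentiable \<rho> by blast+
  have cont: "continuous_on ?W \<rho>1" "continuous_on ?W \<rho>2" "continuous_on ?W (partial_deriv i \<rho>1)"
    "continuous_on ?W (partial_deriv i \<rho>2)" for i
    using \<rho> C1_on_continuous unfolding C1_on_iff by (blast intro: continuous_on_subset)+
  have "continuous_on ?W (\<lambda>x. (partial_deriv i \<rho>1 x * \<rho>2 x - \<rho>1 x * partial_deriv i \<rho>2 x) / (\<rho>2 x * \<rho>2 x))" for i
    by (intro continuous_intros cont) auto
  then have "continuous_on ?W (partial_deriv i (\<lambda>x. \<rho>1 x / \<rho>2 x))" for i
    by (rule continuous_on_eq) (simp add: ratio_partial_deriv(2)[OF diff])
  then have "C1_on ?W (\<lambda>x. \<rho>1 x / \<rho>2 x)"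
    unfolding C1_on_iff using ratio_partial_deriv(1)[OF diff] by blast
  moreover have "deriv_along v (\<lambda>x. \<rho>1 x / \<rho>2 x) x = 0" if x: "x \<in> ?W" for x
  proof -
    have "deriv_along v (\<lambda>x. \<rho>1 x / \<rho>2 x) x
      = (deriv_along v \<rho>1 x * \<rho>2 x - \<rho>1 x * deriv_along v \<rho>2 x) / (\<rho>2 x * \<rho>2 x)"
      unfolding deriv_along_def ratio_partial_deriv(2)[OF diff[OF x]]
      by (simp add: sum_distrib_left sum_distrib_right sum_subtractf[symmetric] sum_divide_distrib algebra_simps)
    also have "deriv_along v \<rho>1 x = - \<rho>1 x * divergence v x" using pde(1) x by (simp add: eq_neg_iff_add_eq_0)
    also have "deriv_along v \<rho>2 x = - \<rho>2 x * divergence v x" using pde(2) x by (simp add: eq_neg_iff_add_eq_0)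
    finally show ?thesis by simp
  qed
  ultimately show ?thesis using W by (simp add: integral_of_flow_def)
qed

theorem theorem2:
  fixes v :: "real ^ 'n \<Rightarrow> real ^ 'n" and U :: "(real ^ 'n) set"
  assumes "CARD('n) \<ge> 2"
    and "\<forall>i. C1_on UNIV (\<lambda>x. v x $ i)"
    and "open U"
  shows "(\<forall>\<rho>. C1_on U \<rho> \<longrightarrow>
            (preserved_by_flow v U \<rho> \<longleftrightarrow>
               (\<forall>x\<in>U. deriv_along v \<rho> x + \<rho> x * divergence v x = 0))) \<and>
         (\<forall>\<rho>1 \<rho>2. C1_on U \<rho>1 \<and> C1_on U \<rho>2 \<and> independent_densities U \<rho>1 \<rho>2 \<and>
            preserved_by_flow v U \<rho>1 \<and> preserved_by_flow v U \<rho>2 \<longrightarrow>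
            integral_of_flow v {x\<in>U. \<rho>2 x \<noteq> 0} (\<lambda>x. \<rho>1 x / \<rho>2 x))"
proof -
  obtain DV where "\<And>z. (v has_derivative blinfun_apply (DV z)) (at z)" "continuous_on UNIV DV"
    using C1_field_derivative[OF assms(2)] by blast
  then interpret C1_field v DV by unfold_locales
  note iff = preserved_by_flow_iff[OF assms(2,3)]
  show ?thesis
    using iff ratio_of_solutions_is_integral[OF assms(3)] by blast
qed

end
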